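(* Let $K$ be a number field which is Galois over $\mathbb{Q}$ and has class number $1$, and let $n=[K:\mathbb{Q}]$. Let $\mathcal{O}$ be a Galois-invariant order of $K$ whose conductor $\mathfrak{f}=\{\alpha\in\mathcal{O}_K \mid \alpha\mathcal{O}_K\subseteq\mathcal{O}\}$ is a prime ideal of $\mathcal{O}_K$, and such that $U(\mathcal{O}) = U(\mathcal{O}_K)$. If $\rho(\mathcal{O})$ is finite, then $\bar{D}(\mathcal{O})$ is finite; in particular, $$\bar{D}(\mathcal{O}) \leq n(\rho(\mathcal{O}) - 1) + 1.$$
   Context: $\mathcal{O}_K$ is the ring of integers of $K$, and $U(\cdot)$ denotes the unit group. An order $\mathcal{O}$ of a Galois number field $K$ is called Galois-invariant if $\sigma(\alpha)\in\mathcal{O}$ for all $\alpha\in\mathcal{O}$ and all $\sigma\in\mathrm{Gal}(K/\mathbb{Q})$. For an atomic domain $R$ and a non-empty subset $\mathcal{O}\subseteq R$: an $R$-product of length $m$ is a formal product (finite sequence, repetitions allowed) $\pi_1\pi_2\cdots\pi_m$ of irreducible elements $\pi_i\in \mathrm{Irr}(R)$; it is an $\mathcal{O}$-product if its value lies in $\mathcal{O}$. An $\mathcal{O}$-subproduct of an $R$-product is a non-empty subproduct (over a non-empty subset of the indices, possibly all of them) which is an $\mathcal{O}$-product. Define $D_{\mathcal{O}}(R) = \min\{m \mid \text{any } R\text{-product of length } m \text{ has an } \mathcal{O}\text{-subproduct}\}$, and $D_{\mathcal{O}}(R)=\infty$ if no such $m$ exists. If $\mathcal{O}$ is a domain and $R$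 is its integral closure, write $\bar{D}(\mathcal{O}) = D_{\mathcal{O}}(R)$; for an order $\mathcal{O}\subseteq\mathcal{O}_K$ this is $D_{\mathcal{O}}(\mathcal{O}_K)$. The elasticity of an atomic domain $R$ is $\rho(R) = \sup\{ k/m \mid \alpha_1\cdots\alpha_k = \beta_1\cdots\beta_m,\ \alpha_i,\beta_j\in\mathrm{Irr}(R)\}$, possibly $\infty$. *)

theory Defs
  imports
    "HOL-Algebra.Algebra"
    "HOL-Algebra.Algebraic_Closure_Type"
    "HOL-Library.Extended_Real"
begin

text \<open>
  Number fields are subfields \<open>K\<close> of an arbitrary ambient field of characteristic \<open>0\<close>
  (for instance the complex numbers).  Rings and orders inside \<open>K\<close> are subsets of the ambient
  field; \<open>ring_on S\<close> is the corresponding structure, so that the notions of HOL-Algebra apply.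
\<close>

definition ring_on :: "'a::comm_ring_1 set \<Rightarrow> 'a ring" where
  "ring_on S = ring_of_type_algebra\<lparr>carrier := S\<rparr>"

definition rat_scale :: "rat \<Rightarrow> 'a::field_char_0 \<Rightarrow> 'a" where
  "rat_scale q x = of_rat q * x"

definition int_scale :: "int \<Rightarrow> 'a::field_char_0 \<Rightarrow> 'a" where
  "int_scale z x = of_int z * x"


section \<open>Number fields\<close>

definition number_field :: "'a::field_char_0 set \<Rightarrow> bool" where
  "number_field K \<longleftrightarrow> subfield K ring_of_type_algebra \<and>
     (\<exists>B. finite B \<and> module.span rat_scale B = K)"

definition field_degree :: "'a::field_char_0 set \<Rightarrow> nat" where
  "field_degree K = vector_space.dim rat_scale K"

text \<open>Elements of \<open>galois_group K\<close> are functions on the ambient field of which only the values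
  on \<open>K\<close> matter.\<close>

definition galois_group :: "'a::field_char_0 set \<Rightarrow> ('a \<Rightarrow> 'a) set" where
  "galois_group K = {\<sigma> \<in> ring_iso (ring_on K) (ring_on K). \<forall>q\<in>\<rat>. \<sigma> q = q}"

text \<open>Artin's definition of a Galois extension, for \<open>K\<close> algebraic over the rationals.\<close>

definition galois_over_rat :: "'a::field_char_0 set \<Rightarrow> bool" where
  "galois_over_rat K \<longleftrightarrow> {x \<in> K. \<forall>\<sigma>\<in>galois_group K. \<sigma> x = x} = \<rat>"

definition ring_of_integers :: "'a::field_char_0 set \<Rightarrow> 'a set" where
  "ring_of_integers K = {x \<in> K. algebraic_int x}"


section \<open>The class number\<close>

definition fractional_ideal :: "'a::field_char_0 set \<Rightarrow> 'a set \<Rightarrow> bool" where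
  "fractional_ideal K I \<longleftrightarrow>
     I \<subseteq> K \<and> 0 \<in> I \<and> I \<noteq> {0} \<and>
     (\<forall>x\<in>I. \<forall>y\<in>I. x + y \<in> I) \<and>
     (\<forall>a\<in>ring_of_integers K. \<forall>x\<in>I. a * x \<in> I) \<and>
     (\<exists>d\<in>ring_of_integers K. d \<noteq> 0 \<and> (\<forall>x\<in>I. d * x \<in> ring_of_integers K))"

text \<open>Two fractional ideals lie in the same coset of the principal fractional ideals iff they
  differ by a factor from the unit group of \<open>K\<close>.\<close>

definition ideal_class_rel :: "'a::field_char_0 set \<Rightarrow> ('a set \<times> 'a set) set" where
  "ideal_class_rel K =
     {(I, J). fractional_ideal K I \<and> fractional_ideal K J \<and>
              (\<exists>c\<in>K. c \<noteq> 0 \<and> J = (\<lambda>x. c * x) ` I)}"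

definition class_number :: "'a::field_char_0 set \<Rightarrow> nat" where
  "class_number K = card ({I. fractional_ideal K I} // ideal_class_rel K)"


section \<open>Orders\<close>

text \<open>A subring which is a free abelian group of rank \<open>[K:Q]\<close>, i.e. the integer span of a
  rational basis of \<open>K\<close>.\<close>

definition is_order :: "'a::field_char_0 set \<Rightarrow> 'a set \<Rightarrow> bool" where
  "is_order K \<O> \<longleftrightarrow> subring \<O> (ring_on K) \<and>
     (\<exists>B. \<not> module.dependent rat_scale B \<and> module.span rat_scale B = K \<and>
          \<O> = module.span int_scale B)"

definition galois_invariant :: "'a::field_char_0 set \<Rightarrow> 'a set \<Rightarrow> bool" where
  "galois_invariant K \<O> \<longleftrightarrow> (\<forall>\<sigma>\<in>galois_group K. \<forall>\<alpha>\<in>\<O>. \<sigma> \<alpha> \<in> \<O>)"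

definition conductor :: "'a::field_char_0 set \<Rightarrow> 'a set \<Rightarrow> 'a set" where
  "conductor K \<O> =
     {\<alpha> \<in> ring_of_integers K. \<forall>\<beta>\<in>ring_of_integers K. \<alpha> * \<beta> \<in> \<O>}"


section \<open>Factorization\<close>

text \<open>\<open>ring_irreducible\<close> does not itself require membership in the carrier.\<close>

definition Irr :: "'a::idom set \<Rightarrow> 'a set" where
  "Irr R = {a \<in> R. ring_irreducible\<^bsub>ring_on R\<^esub> a}"

text \<open>\<open>subproduct_property \<O> R m\<close>: every \<open>R\<close>-product of length \<open>m\<close> has an
  \<open>\<O>\<close>-subproduct; an \<open>R\<close>-product is a list of irreducibles and \<open>J\<close> is the set of indices
  of the subproduct.\<close>

definition subproduct_property :: "'a::idom set \<Rightarrow> 'a set \<Rightarrow> nat \<Rightarrow> bool" where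
  "subproduct_property \<O> R m \<longleftrightarrow>
     (\<forall>xs. length xs = m \<and> set xs \<subseteq> Irr R \<longrightarrow>
        (\<exists>J. J \<noteq> {} \<and> J \<subseteq> {..<m} \<and> (\<Prod>i\<in>J. xs ! i) \<in> \<O>))"

text \<open>The infimum of the empty set of extended naturals is \<open>\<infinity>\<close>.\<close>

definition relative_Davenport :: "'a::idom set \<Rightarrow> 'a set \<Rightarrow> enat" where
  "relative_Davenport \<O> R = (INF m \<in> {m. subproduct_property \<O> R m}. enat m)"

definition Davenport_bar :: "'a::field_char_0 set \<Rightarrow> 'a set \<Rightarrow> enat" where
  "Davenport_bar K \<O> = relative_Davenport \<O> (ring_of_integers K)"

definition elasticity :: "'a::idom set \<Rightarrow> ereal" where
  "elasticity R =
     Sup {ereal (real (length as) / real (length bs)) | as bs.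
            as \<noteq> [] \<and> bs \<noteq> [] \<and> set as \<subseteq> Irr R \<and> set bs \<subseteq> Irr R \<and>
            prod_list as = prod_list bs}"

end

(*
  Since the class number is 1, the conductor is generated by a prime element p.  If
  pi_1, ..., pi_m are irreducible in the maximal order and no subproduct lies in the order, then
  q = p pi_1 ... pi_m is irreducible in the order.  By Galois invariance all conjugates of p and q
  are irreducible too, and Norm(q) = Norm(p) Norm(pi_1) ... Norm(pi_m) where every Norm(pi_i) is a
  rational integer, hence a nonunit of the order.  This rewrites a product of |Gal| irreducibles as
  one of at least |Gal| + m irreducibles, so the elasticity is at least 1 + m / |Gal|.

  That the conductor is nonzero follows from the nondegeneracy of the trace form: the coordinates
  of an algebraic integer with respect to the dual of an integral basis are rational integers.
*)

theory Submission
  imports Defs "Jordan_Normal_Form.Char_Poly"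
begin

section \<open>Linear algebra and integrality\<close>

text \<open>No part of pi_1 ... pi_m lies in the order, so these factors cannot be split off from q
  inside the order. Norms bring them back: each pi_i is replaced by a rational integer, at the price
  of taking one conjugate of p and of q for every automorphism. This is the origin of the factor n
  in the bound: |Gal| conjugates of q face |Gal| conjugates of p and at least m further
  irreducibles, and |Gal| <= n weakens 1 + m / |Gal| to 1 + m / n.

  The zero ideal of a domain is prime, so primality of the conductor does not exclude a zero
  conductor. Only a nonzero ideal counts as a fractional ideal and gets a nonzero generator p from
  class number 1; hence the detour through the trace form.\<close>

text \<open>Gaussian elimination, by induction on the equations. It serves twice: with automorphisms
  as unknowns it bounds the Galois group, and with one additional unknown it produces dual
  bases.\<close>

lemma exists_nontrivial_solution:
  fixes a :: "'i \<Rightarrow> 'j \<Rightarrow> 'b::field"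
  assumes "finite J" "finite I" "card J < card I"
  shows "\<exists>c. (\<exists>i\<in>I. c i \<noteq> 0) \<and> (\<forall>j\<in>J. (\<Sum>i\<in>I. c i * a i j) = 0)"
  using assms
proof (induction J arbitrary: I a rule: finite_induct)
  case empty
  then have "I \<noteq> {}" by auto
  then show ?case by (intro exI[of _ "\<lambda>_. 1"]) auto
next
  case (insert j0 J)
  show ?case
  proof (cases "\<exists>i\<in>I. a i j0 \<noteq> 0")
    case False
    have "card J < card I" using insert by simp
    from insert.IH[OF insert.prems(1) this, of a] obtain c
      where "\<exists>i\<in>I. c i \<noteq> 0" "\<forall>j\<in>J. (\<Sum>i\<in>I. c i * a i j) = 0" by blast
    with False show ?thesis by (intro exI[of _ c]) simp
  next
    case True
    then obtain k where k: "k \<in> I" "a k j0 \<noteq> 0" by blast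
    \<comment> \<open>The equation \<open>j0\<close> eliminates the unknown \<open>k\<close>; every
      new coefficient \<open>a' i j0\<close> vanishes.\<close>
    define a' where "a' i j = a i j - a i j0 / a k j0 * a k j" for i j
    have fin: "finite (I - {k})" and lt: "card J < card (I - {k})"
      using insert k by simp_all
    from insert.IH[OF fin lt, of a'] obtain c where c: "\<exists>i\<in>I - {k}. c i \<noteq> 0"
      "\<forall>j\<in>J. (\<Sum>i\<in>I - {k}. c i * a' i j) = 0" by blast
    \<comment> \<open>The value of the unknown \<open>k\<close> that the equation \<open>j0\<close>
      forces.\<close>
    define s where "s = - (\<Sum>i\<in>I - {k}. c i * (a i j0 / a k j0))"
    define d where "d = c(k := s)"
    have d: "(\<Sum>i\<in>I. d i * a i j) = (\<Sum>i\<in>I - {k}. c i * a' i j)" for j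
    proof -
      have "(\<Sum>i\<in>I. d i * a i j) = s * a k j + (\<Sum>i\<in>I - {k}. c i * a i j)"
        using insert.prems(1) k(1) by (subst sum.remove[of _ k]) (auto simp: d_def)
      also have "\<dots> = (\<Sum>i\<in>I - {k}. c i * a' i j)"
        by (simp only: s_def a'_def right_diff_distrib sum_subtractf sum_distrib_right
            mult_minus_left mult.assoc) simp
      finally show ?thesis .
    qed
    have "a' i j0 = 0" for i using k(2) by (simp add: a'_def)
    with c(2) d have "\<forall>j\<in>insert j0 J. (\<Sum>i\<in>I. d i * a i j) = 0" by simp
    moreover have "\<exists>i\<in>I. d i \<noteq> 0" using c(1) by (auto simp: d_def)
    ultimately show ?thesis by blast
  qed
qed

text \<open>Dedekind's argument: subtracting \<open>\<tau> y\<close> times the relation at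
  \<open>x\<close> from the relation at \<open>m y x\<close> removes the term of
  \<open>\<tau>\<close>. By induction the coefficients
  \<open>c \<sigma> * (\<sigma> y - \<tau> y)\<close> vanish, and a \<open>y\<close> separating
  \<open>\<sigma>\<close> from \<open>\<tau>\<close> gives \<open>c \<sigma> = 0\<close>. The
  operation \<open>m\<close> is a parameter because the source type carries no
  multiplication.\<close>

lemma linear_independence_of_characters:
  fixes S :: "('a \<Rightarrow> 'b::field) set"
  assumes "finite S"
    and mult: "\<And>\<sigma> x y. \<sigma> \<in> S \<Longrightarrow> x \<in> K \<Longrightarrow> y \<in> K \<Longrightarrow> \<sigma> (m x y) = \<sigma> x * \<sigma> y"
    and closed: "\<And>x y. x \<in> K \<Longrightarrow> y \<in> K \<Longrightarrow> m x y \<in> K"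
    and nonzero: "\<And>\<sigma>. \<sigma> \<in> S \<Longrightarrow> \<exists>x\<in>K. \<sigma> x \<noteq> 0"
    and distinct: "\<And>\<sigma> \<tau>. \<sigma> \<in> S \<Longrightarrow> \<tau> \<in> S \<Longrightarrow> \<sigma> \<noteq> \<tau> \<Longrightarrow> \<exists>x\<in>K. \<sigma> x \<noteq> \<tau> x"
    and relation: "\<And>x. x \<in> K \<Longrightarrow> (\<Sum>\<sigma>\<in>S. c \<sigma> * \<sigma> x) = 0"
  shows "\<forall>\<sigma>\<in>S. c \<sigma> = 0"
  using assms
proof (induction S arbitrary: c rule: finite_induct)
  case (insert \<tau> S)
  have rel: "c \<tau> * \<tau> x + (\<Sum>\<sigma>\<in>S. c \<sigma> * \<sigma> x) = 0" if "x \<in> K" for x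
    using insert.prems(5)[OF that] insert.hyps by simp
  have zero: "c \<sigma> * (\<sigma> y - \<tau> y) = 0" if "\<sigma> \<in> S" "y \<in> K" for \<sigma> y
  proof -
    have "(\<Sum>\<sigma>\<in>S. (c \<sigma> * (\<sigma> y - \<tau> y)) * \<sigma> x) = 0" if x: "x \<in> K" for x
    proof -
      have "(\<Sum>\<sigma>\<in>S. (c \<sigma> * (\<sigma> y - \<tau> y)) * \<sigma> x)
          = (\<Sum>\<sigma>\<in>S. c \<sigma> * \<sigma> (m y x)) - \<tau> y * (\<Sum>\<sigma>\<in>S. c \<sigma> * \<sigma> x)"
        unfolding sum_distrib_left sum_subtractf[symmetric]
      proof (rule sum.cong[OF refl])
        fix \<sigma> assume "\<sigma> \<in> S"
        then have "\<sigma> (m y x) = \<sigma> y * \<sigma> x"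
          by (intro insert.prems(1) \<open>y \<in> K\<close> x) simp
        then show "c \<sigma> * (\<sigma> y - \<tau> y) * \<sigma> x = c \<sigma> * \<sigma> (m y x) - \<tau> y * (c \<sigma> * \<sigma> x)"
          by (simp only:) (simp add: algebra_simps)
      qed
      moreover have "(\<Sum>\<sigma>\<in>S. c \<sigma> * \<sigma> (m y x)) = - (c \<tau> * \<tau> (m y x))"
        using rel[OF closed[OF \<open>y \<in> K\<close> x]] by (simp only: add_eq_0_iff)
      moreover have "(\<Sum>\<sigma>\<in>S. c \<sigma> * \<sigma> x) = - (c \<tau> * \<tau> x)"
        using rel[OF x] by (simp only: add_eq_0_iff)
      moreover have "\<tau> (m y x) = \<tau> y * \<tau> x"
        by (rule insert.prems(1)) (use \<open>y \<in> K\<close> x in auto)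
      ultimately show ?thesis by simp
    qed
    then have "\<forall>\<sigma>\<in>S. c \<sigma> * (\<sigma> y - \<tau> y) = 0"
      by (intro insert.IH) (use insert.prems in auto)
    with that show ?thesis by blast
  qed
  have S0: "c \<sigma> = 0" if "\<sigma> \<in> S" for \<sigma>
  proof -
    obtain y where "y \<in> K" "\<sigma> y \<noteq> \<tau> y"
      using insert.prems(4)[of \<sigma> \<tau>] insert.hyps \<open>\<sigma> \<in> S\<close> by blast
    with zero[OF that] show ?thesis by auto
  qed
  obtain x where "x \<in> K" "\<tau> x \<noteq> 0" using insert.prems(3)[of \<tau>] by auto
  with rel[of x] S0 have "c \<tau> = 0" by simp
  with S0 show ?case by simp
qed simp

section \<open>Rational and integral spans, and integrality\<close>

interpretation rat_vs: vector_space rat_scale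
  by unfold_locales (simp_all add: rat_scale_def algebra_simps of_rat_add of_rat_mult)

interpretation int_mod: Modules.module int_scale
  by unfold_locales (simp_all add: int_scale_def algebra_simps)

text \<open>Determinant trick: the members of \<open>B\<close> form an eigenvector, with eigenvalue
  \<open>x\<close>, of an integer matrix, whose characteristic polynomial is monic over the
  integers. The nonzero member of \<open>B\<close> makes the eigenvector nonzero.\<close>

lemma algebraic_int_if_stable_span:
  fixes x :: "'a::field_char_0"
  assumes "finite B" "\<exists>b\<in>B. b \<noteq> 0"
    and stable: "\<And>b. b \<in> B \<Longrightarrow> x * b \<in> int_mod.span B"
  shows "algebraic_int x"
proof -
  obtain f where f: "bij_betw f {0..<card B} B"
    using ex_bij_betw_nat_finite[OF \<open>finite B\<close>] by blast
  define n where "n = card B"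
  have "\<exists>u. x * b = (\<Sum>v\<in>B. int_scale (u v) v)" if "b \<in> B" for b
    using stable[OF that] \<open>finite B\<close> by (auto simp: int_mod.span_finite)
  then obtain u where u: "\<And>b. b \<in> B \<Longrightarrow> x * b = (\<Sum>v\<in>B. int_scale (u b v) v)"
    by metis
  define M where "M = mat n n (\<lambda>(i,j). u (f i) (f j))"
  define A :: "'a mat" where "A = map_mat of_int M"
  define w where "w = vec n f"
  have M: "M \<in> carrier_mat n n" and A: "A \<in> carrier_mat n n"
    by (simp_all add: M_def A_def)
  have fB: "f i \<in> B" if "i < n" for i
    using f that by (auto simp: bij_betw_def n_def)
  have "A *\<^sub>v w = x \<cdot>\<^sub>v w"
  proof (rule eq_vecI)
    fix i assume "i < dim_vec (x \<cdot>\<^sub>v w)"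
    then have i: "i < n" by (simp add: w_def)
    have "(A *\<^sub>v w) $ i = (\<Sum>j = 0..<n. int_scale (u (f i) (f j)) (f j))"
      using i by (simp add: A_def M_def w_def scalar_prod_def int_scale_def)
    also have "\<dots> = (\<Sum>v\<in>B. int_scale (u (f i) v) v)"
      using f by (intro sum.reindex_bij_betw) (simp add: n_def)
    also have "\<dots> = (x \<cdot>\<^sub>v w) $ i" using i u[OF fB[OF i]] by (simp add: w_def)
    finally show "(A *\<^sub>v w) $ i = (x \<cdot>\<^sub>v w) $ i" .
  qed (simp add: A_def M_def w_def)
  moreover have "w \<noteq> 0\<^sub>v n"
  proof
    assume w0: "w = 0\<^sub>v n"
    have "f i = 0" if "i < n" for i
      using w0 that by (metis index_vec index_zero_vec(1) w_def)
    then show False using assms(2) f by (auto simp: bij_betw_def n_def)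
  qed
  ultimately have "eigenvalue A x"
    using A by (auto simp: eigenvalue_def eigenvector_def w_def A_def M_def intro!: exI[of _ w])
  then have "poly (char_poly A) x = 0" using eigenvalue_root_char_poly[OF A] by simp
  moreover have "char_poly A = map_poly of_int (char_poly M)"
    unfolding A_def by (rule of_int_hom.char_poly_hom[OF M])
  moreover have "lead_coeff (char_poly M) = 1" using degree_monic_char_poly[OF M] by simp
  ultimately show ?thesis unfolding algebraic_int_altdef_ipoly by metis
qed

section \<open>Units and irreducible elements\<close>

lemma ring_on_simps [simp]:
  "carrier (ring_on S) = S"
  "x \<otimes>\<^bsub>ring_on S\<^esub> y = x * y"
  "\<one>\<^bsub>ring_on S\<^esub> = 1"
  "x \<oplus>\<^bsub>ring_on S\<^esub> y = x + y"
  "\<zero>\<^bsub>ring_on S\<^esub> = 0"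
  by (simp_all add: ring_on_def ring_of_type_algebra_def)

lemma mem_Units_ring_on:
  "x \<in> Units (ring_on S) \<longleftrightarrow> x \<in> S \<and> (\<exists>y\<in>S. x * y = 1)"
  unfolding Units_def by (simp add: mult.commute[of _ x])

text \<open>Irreducibility in HOL-Algebra speaks of proper factors. In \<open>a = b * c\<close> with
  \<open>a \<noteq> 0\<close>, cancelling \<open>b\<close> shows that \<open>b\<close> is a proper
  factor exactly when \<open>c\<close> is not a unit, which gives the usual criterion.\<close>

lemma mem_Irr_iff:
  fixes S :: "'a::idom set"
  shows "a \<in> Irr S \<longleftrightarrow> a \<in> S \<and> a \<noteq> 0 \<and> a \<notin> Units (ring_on S) \<and>
    (\<forall>b\<in>S. \<forall>c\<in>S. a = b * c \<longrightarrow> b \<in> Units (ring_on S) \<or> c \<in> Units (ring_on S))"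
  (is "?L \<longleftrightarrow> ?R")
proof -
  have proper: "properfactor (ring_on S) b a \<longleftrightarrow> (\<exists>c\<in>S. a = b * c) \<and> \<not> (\<exists>c\<in>S. b = a * c)" for b
    unfolding properfactor_def factor_def ring_on_simps by (rule refl)
  have irr: "?L \<longleftrightarrow> a \<in> S \<and> a \<noteq> 0 \<and> a \<notin> Units (ring_on S) \<and>
      (\<forall>b\<in>S. properfactor (ring_on S) b a \<longrightarrow> b \<in> Units (ring_on S))"
    unfolding Irr_def ring_irreducible_def irreducible_def ring_on_simps by blast
  have "(\<exists>e\<in>S. b = a * e) \<longleftrightarrow> c \<in> Units (ring_on S)"
    if "a \<noteq> 0" "c \<in> S" and a: "a = b * c" for b c
  proof -
    have "b = a * e \<longleftrightarrow> c * e = 1" for e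
    proof -
      have "b = a * e \<longleftrightarrow> b * 1 = b * (c * e)" unfolding a by (simp only: mult.assoc mult_1_right)
      also have "\<dots> \<longleftrightarrow> c * e = 1" using that by (simp only: mult_cancel_left) auto
      finally show ?thesis .
    qed
    then show ?thesis using that by (simp add: mem_Units_ring_on)
  qed
  then show ?thesis unfolding irr proper by metis
qed

lemma IrrD:
  fixes a :: "'a::idom"
  assumes "a \<in> Irr S"
  shows "a \<in> S" "a \<noteq> 0" "a \<notin> Units (ring_on S)"
  using assms unfolding mem_Irr_iff by blast+

section \<open>The Galois group, norm and trace\<close>

locale galois_number_field =
  fixes K :: "'a::field_char_0 set"
  assumes number_field: "number_field K"
    and galois: "galois_over_rat K"
begin

lemma subfield: "subfield K ring_of_type_algebra"
  using number_field by (simp add: number_field_def)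

lemma K_span: obtains B where "finite B" "rat_vs.span B = K"
  using number_field by (auto simp: number_field_def)

lemma K_subspace: "rat_vs.subspace K"
  using K_span rat_vs.subspace_span by metis

lemma K_add: "x \<in> K \<Longrightarrow> y \<in> K \<Longrightarrow> x + y \<in> K"
  using rat_vs.subspace_add[OF K_subspace] .

lemma K_zero: "0 \<in> K"
  using rat_vs.subspace_0[OF K_subspace] .

lemma K_sum: "(\<And>i. i \<in> I \<Longrightarrow> f i \<in> K) \<Longrightarrow> sum f I \<in> K"
  using rat_vs.subspace_sum[OF K_subspace] .

lemma K_mult: "x \<in> K \<Longrightarrow> y \<in> K \<Longrightarrow> x * y \<in> K"
proof -
  interpret subfield K "ring_of_type_algebra" by (rule subfield)
  assume "x \<in> K" "y \<in> K"
  then have "x \<otimes>\<^bsub>ring_of_type_algebra\<^esub> y \<in> K" by (rule m_closed)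
  then show ?thesis by (simp add: ring_of_type_algebra_def)
qed

lemma K_one: "1 \<in> K"
proof -
  interpret subfield K "ring_of_type_algebra" by (rule subfield)
  have "\<one>\<^bsub>ring_of_type_algebra\<^esub> \<in> K" by (rule one_closed)
  then show ?thesis by (simp add: ring_of_type_algebra_def)
qed

lemma K_inverse:
  assumes "x \<in> K"
  shows "inverse x \<in> K"
proof (cases "x = 0")
  case False
  interpret subfield K "ring_of_type_algebra" by (rule subfield)
  have "Units (ring_on K) = K - {0}"
    using subfield_Units by (simp add: ring_on_def) (simp add: ring_of_type_algebra_def)
  then have "x \<in> Units (ring_on K)" using assms False by simp
  then obtain y where "y \<in> K" "x * y = 1" by (auto simp: mem_Units_ring_on)
  then show ?thesis by (metis inverse_unique)
qed (use K_zero in simp)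

lemma K_of_rat: "of_rat q \<in> K"
  using rat_vs.subspace_scale[OF K_subspace K_one, of q] by (simp add: rat_scale_def)

lemma Rats_K: "q \<in> \<rat> \<Longrightarrow> q \<in> K"
  by (elim Rats_cases) (simp add: K_of_rat)

lemma K_of_int: "of_int z \<in> K"
  using K_of_rat[of "of_int z"] by simp

lemma K_prod: "(\<And>i. i \<in> I \<Longrightarrow> f i \<in> K) \<Longrightarrow> prod f I \<in> K"
  by (induction I rule: infinite_finite_induct) (auto intro: K_one K_mult)

lemma galois_group_iff:
  "\<sigma> \<in> galois_group K \<longleftrightarrow> bij_betw \<sigma> K K \<and> (\<forall>x\<in>K. \<forall>y\<in>K. \<sigma> (x + y) = \<sigma> x + \<sigma> y) \<and>
     (\<forall>x\<in>K. \<forall>y\<in>K. \<sigma> (x * y) = \<sigma> x * \<sigma> y) \<and> (\<forall>q\<in>\<rat>. \<sigma> q = q)"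
proof -
  have "\<sigma> \<in> K \<rightarrow> K" if "bij_betw \<sigma> K K" using that by (auto dest: bij_betwE)
  moreover have "\<sigma> 1 = 1" if "\<forall>q\<in>\<rat>. \<sigma> q = q" using that Rats_1 by blast
  ultimately show ?thesis
    unfolding galois_group_def ring_iso_def Ring.ring_hom_def ring_on_simps mem_Collect_eq by blast
qed

text \<open>Only the values on \<open>K\<close> of an element of \<^const>\<open>galois_group\<close> are determined,
  so products over the Galois group range over the extensional representatives.\<close>

definition Gal :: "('a \<Rightarrow> 'a) set" where
  "Gal = galois_group K \<inter> extensional K"

definition Norm :: "'a \<Rightarrow> 'a" where "Norm x = (\<Prod>\<sigma>\<in>Gal. \<sigma> x)"

definition Trace :: "'a \<Rightarrow> 'a" where "Trace x = (\<Sum>\<sigma>\<in>Gal. \<sigma> x)"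

context
  fixes \<sigma>
  assumes \<sigma>: "\<sigma> \<in> galois_group K"
begin

lemma gal_bij: "bij_betw \<sigma> K K"
  and gal_add: "x \<in> K \<Longrightarrow> y \<in> K \<Longrightarrow> \<sigma> (x + y) = \<sigma> x + \<sigma> y"
  and gal_mult: "x \<in> K \<Longrightarrow> y \<in> K \<Longrightarrow> \<sigma> (x * y) = \<sigma> x * \<sigma> y"
  and gal_rat: "q \<in> \<rat> \<Longrightarrow> \<sigma> q = q"
  using \<sigma> by (auto simp: galois_group_iff)

lemma gal_K: "x \<in> K \<Longrightarrow> \<sigma> x \<in> K"
  using gal_bij by (auto simp: bij_betw_def)

lemma gal_eq_0_iff: "x \<in> K \<Longrightarrow> \<sigma> x = 0 \<longleftrightarrow> x = 0"
  using inj_on_eq_iff[of \<sigma> K x 0] bij_betw_imp_inj_on[OF gal_bij] gal_rat[of 0] K_zero by simp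

lemma gal_sum: "(\<And>i. i \<in> I \<Longrightarrow> f i \<in> K) \<Longrightarrow> \<sigma> (sum f I) = (\<Sum>i\<in>I. \<sigma> (f i))"
  by (induction I rule: infinite_finite_induct) (auto simp: gal_rat gal_add K_sum)

lemma gal_prod: "(\<And>i. i \<in> I \<Longrightarrow> f i \<in> K) \<Longrightarrow> \<sigma> (prod f I) = (\<Prod>i\<in>I. \<sigma> (f i))"
  by (induction I rule: infinite_finite_induct) (auto simp: gal_rat gal_mult K_prod)

lemma gal_rat_scale: "x \<in> K \<Longrightarrow> \<sigma> (rat_scale q x) = rat_scale q (\<sigma> x)"
  by (simp add: rat_scale_def gal_mult K_of_rat gal_rat)

text \<open>Membership in \<open>K\<close> is carried through the induction because
  \<open>\<sigma>\<close> respects sums and products only there.\<close>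

lemma gal_poly:
  assumes "x \<in> K"
  shows "poly (map_poly of_int p) x \<in> K \<and>
    \<sigma> (poly (map_poly of_int p) x) = poly (map_poly of_int p) (\<sigma> x)"
proof (induction p)
  case (pCons a p)
  then show ?case using assms
    by (simp add: map_poly_pCons K_of_int K_add K_mult gal_add gal_mult gal_rat)
qed (simp add: K_zero gal_rat)

lemma gal_algebraic_int:
  assumes "x \<in> K" "algebraic_int x"
  shows "algebraic_int (\<sigma> x)"
proof -
  obtain p where "poly (map_poly of_int p) x = 0" "lead_coeff p = 1"
    using assms(2) unfolding algebraic_int_altdef_ipoly by blast
  then show ?thesis
    unfolding algebraic_int_altdef_ipoly using gal_poly[OF assms(1), of p] gal_rat[of 0] by auto
qed

lemma gal_inv: "inv_into K \<sigma> \<in> galois_group K"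
proof -
  have inj: "inj_on \<sigma> K" and img: "\<sigma> ` K = K" using gal_bij by (auto simp: bij_betw_def)
  have inv: "\<sigma> (inv_into K \<sigma> x) = x" "inv_into K \<sigma> x \<in> K" if "x \<in> K" for x
    using that img by (auto intro: f_inv_into_f inv_into_into)
  have eqI: "inv_into K \<sigma> (\<sigma> y) = y" if "y \<in> K" for y
    using that inj by (rule inv_into_f_f[rotated])
  show ?thesis
    unfolding galois_group_iff
  proof (intro conjI ballI)
    show "bij_betw (inv_into K \<sigma>) K K" by (rule bij_betw_inv_into[OF gal_bij])
    fix x y assume "x \<in> K" "y \<in> K"
    note iv = inv[OF this(1)] inv[OF this(2)]
    show "inv_into K \<sigma> (x + y) = inv_into K \<sigma> x + inv_into K \<sigma> y"
      using eqI[OF K_add[OF iv(2) iv(4)]] by (simp only: gal_add[OF iv(2) iv(4)] iv)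
    show "inv_into K \<sigma> (x * y) = inv_into K \<sigma> x * inv_into K \<sigma> y"
      using eqI[OF K_mult[OF iv(2) iv(4)]] by (simp only: gal_mult[OF iv(2) iv(4)] iv)
  next
    fix q :: 'a assume q: "q \<in> \<rat>"
    then show "inv_into K \<sigma> q = q" using eqI[OF Rats_K[OF q]] by (simp only: gal_rat)
  qed
qed

lemma gal_comp:
  assumes \<tau>: "\<tau> \<in> galois_group K"
  shows "compose K \<sigma> \<tau> \<in> Gal"
proof -
  have \<tau>': "bij_betw \<tau> K K" "\<And>x. x \<in> K \<Longrightarrow> \<tau> x \<in> K"
    "\<And>x y. x \<in> K \<Longrightarrow> y \<in> K \<Longrightarrow> \<tau> (x + y) = \<tau> x + \<tau> y"
    "\<And>x y. x \<in> K \<Longrightarrow> y \<in> K \<Longrightarrow> \<tau> (x * y) = \<tau> x * \<tau> y" "\<And>q. q \<in> \<rat> \<Longrightarrow> \<tau> q = q"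
    using \<tau> bij_betwE[of \<tau> K K] unfolding galois_group_iff by blast+
  have "compose K \<sigma> \<tau> \<in> galois_group K"
    unfolding galois_group_iff
  proof (intro conjI ballI)
    show "bij_betw (compose K \<sigma> \<tau>) K K" using \<tau>'(1) gal_bij by (rule bij_betw_compose)
    fix x y assume x: "x \<in> K" and y: "y \<in> K"
    show "compose K \<sigma> \<tau> (x + y) = compose K \<sigma> \<tau> x + compose K \<sigma> \<tau> y"
      by (simp only: compose_eq[OF x] compose_eq[OF y] compose_eq[OF K_add[OF x y]]
          \<tau>'(3)[OF x y] gal_add[OF \<tau>'(2)[OF x] \<tau>'(2)[OF y]])
    show "compose K \<sigma> \<tau> (x * y) = compose K \<sigma> \<tau> x * compose K \<sigma> \<tau> y"
      by (simp only: compose_eq[OF x] compose_eq[OF y] compose_eq[OF K_mult[OF x y]]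
          \<tau>'(4)[OF x y] gal_mult[OF \<tau>'(2)[OF x] \<tau>'(2)[OF y]])
  next
    fix q :: 'a assume q: "q \<in> \<rat>"
    show "compose K \<sigma> \<tau> q = q"
      by (simp only: compose_eq[OF Rats_K[OF q]] \<tau>'(5)[OF q] gal_rat[OF q])
  qed
  then show ?thesis by (simp add: Gal_def)
qed

end

lemma gal_restrict:
  assumes \<sigma>: "\<sigma> \<in> galois_group K"
  shows "restrict \<sigma> K \<in> Gal"
proof -
  have "restrict \<sigma> K \<in> galois_group K"
    unfolding galois_group_iff
  proof (intro conjI ballI)
    show "bij_betw (restrict \<sigma> K) K K"
      using gal_bij[OF \<sigma>] by (rule bij_betw_cong[THEN iffD1, rotated]) simp
    fix x y assume x: "x \<in> K" and y: "y \<in> K"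
    show "restrict \<sigma> K (x + y) = restrict \<sigma> K x + restrict \<sigma> K y"
      by (simp only: restrict_apply' x y K_add[OF x y] gal_add[OF \<sigma> x y])
    show "restrict \<sigma> K (x * y) = restrict \<sigma> K x * restrict \<sigma> K y"
      by (simp only: restrict_apply' x y K_mult[OF x y] gal_mult[OF \<sigma> x y])
  next
    fix q :: 'a assume q: "q \<in> \<rat>"
    show "restrict \<sigma> K q = q"
      by (simp only: restrict_apply' Rats_K[OF q] gal_rat[OF \<sigma> q])
  qed
  then show ?thesis by (simp add: Gal_def)
qed

lemma GalD: "\<sigma> \<in> Gal \<Longrightarrow> \<sigma> \<in> galois_group K"
  by (simp add: Gal_def)

lemma Gal_eqI: "\<sigma> \<in> Gal \<Longrightarrow> \<tau> \<in> Gal \<Longrightarrow> (\<And>x. x \<in> K \<Longrightarrow> \<sigma> x = \<tau> x) \<Longrightarrow> \<sigma> = \<tau>"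
  unfolding Gal_def by (auto intro: extensionalityI)

lemma restrict_id_in_Gal: "restrict id K \<in> Gal"
  by (rule gal_restrict) (simp add: galois_group_iff)

section \<open>Finiteness of the Galois group\<close>

lemma K_basis:
  obtains B where "finite B" "rat_vs.independent B" "rat_vs.span B = K" "card B = field_degree K"
proof -
  obtain B0 where B0: "finite B0" "rat_vs.span B0 = K" by (rule K_span)
  obtain B where B: "B \<subseteq> K" "rat_vs.independent B" "K \<subseteq> rat_vs.span B" "card B = rat_vs.dim K"
    by (rule rat_vs.basis_exists)
  have "finite B" using rat_vs.independent_span_bound[OF B0(1) B(2)] B0(2) B(1) by blast
  moreover have "rat_vs.span B = K"
    using B rat_vs.span_minimal[OF B(1) K_subspace] by blast
  ultimately show ?thesis using B that by (simp add: field_degree_def)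
qed

text \<open>More automorphisms than basis vectors would admit a nontrivial linear relation holding
  on the basis. By rational linearity it holds on all of \<open>K\<close>, against the independence
  of characters.\<close>

lemma card_Gal: "finite Gal \<and> card Gal \<le> field_degree K"
proof -
  obtain B where B: "finite B" "rat_vs.span B = K" "card B = field_degree K"
    by (rule K_basis)
  \<comment> \<open>Restricted to finite \<open>S\<close> because finiteness of \<open>Gal\<close>
    is deduced from this bound afterwards.\<close>
  have bound: "card S \<le> card B" if S: "finite S" "S \<subseteq> Gal" for S
  proof (rule ccontr)
    assume "\<not> card S \<le> card B"
    then have "card B < card S" by simp
    from exists_nontrivial_solution[OF B(1) S(1) this, of "\<lambda>\<sigma>. \<sigma>"] obtain c
      where c: "\<exists>\<sigma>\<in>S. c \<sigma> \<noteq> 0" "\<forall>b\<in>B. (\<Sum>\<sigma>\<in>S. c \<sigma> * \<sigma> b) = 0" by blast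
    have SG: "\<sigma> \<in> galois_group K" if "\<sigma> \<in> S" for \<sigma> using that S GalD by blast
    have "x \<in> K \<and> (\<Sum>\<sigma>\<in>S. c \<sigma> * \<sigma> x) = 0" if "x \<in> K" for x
    proof -
      have "x \<in> rat_vs.span B" using that B by simp
      then show ?thesis
      proof (rule rat_vs.span_induct)
        show "rat_vs.subspace {x. x \<in> K \<and> (\<Sum>\<sigma>\<in>S. c \<sigma> * \<sigma> x) = 0}"
        proof (intro rat_vs.subspaceI CollectI conjI; (elim CollectE conjE)?)
          show "(\<Sum>\<sigma>\<in>S. c \<sigma> * \<sigma> 0) = 0" by (intro sum.neutral ballI) (simp only: gal_rat[OF SG Rats_0] mult_zero_right)
          fix x assume x: "x \<in> K" "(\<Sum>\<sigma>\<in>S. c \<sigma> * \<sigma> x) = 0"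
          fix q
          show "rat_scale q x \<in> K" by (rule rat_vs.subspace_scale[OF K_subspace x(1)])
          have "(\<Sum>\<sigma>\<in>S. c \<sigma> * \<sigma> (rat_scale q x)) = of_rat q * (\<Sum>\<sigma>\<in>S. c \<sigma> * \<sigma> x)"
            unfolding sum_distrib_left
            by (intro sum.cong refl, subst gal_rat_scale[OF SG x(1)])
               (simp_all add: rat_scale_def ac_simps)
          then show "(\<Sum>\<sigma>\<in>S. c \<sigma> * \<sigma> (rat_scale q x)) = 0" using x(2) by simp
          fix y assume y: "y \<in> K" "(\<Sum>\<sigma>\<in>S. c \<sigma> * \<sigma> y) = 0"
          show "x + y \<in> K" by (rule K_add[OF x(1) y(1)])
          have "(\<Sum>\<sigma>\<in>S. c \<sigma> * \<sigma> (x + y)) = (\<Sum>\<sigma>\<in>S. c \<sigma> * \<sigma> x) + (\<Sum>\<sigma>\<in>S. c \<sigma> * \<sigma> y)"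
            unfolding sum.distrib[symmetric]
            by (intro sum.cong refl, subst gal_add[OF SG x(1) y(1)]) (simp_all add: distrib_left)
          then show "(\<Sum>\<sigma>\<in>S. c \<sigma> * \<sigma> (x + y)) = 0" using x(2) y(2) by simp
        qed (rule K_zero)
        show "x \<in> K \<and> (\<Sum>\<sigma>\<in>S. c \<sigma> * \<sigma> x) = 0" if "x \<in> B" for x
          using that c(2) rat_vs.span_base[OF that] B(2) by blast
      qed
    qed
    then have "\<forall>\<sigma>\<in>S. c \<sigma> = 0"
    proof (intro linear_independence_of_characters[where m = "(*)" and K = K])
      show "\<exists>x\<in>K. \<sigma> x \<noteq> 0" if "\<sigma> \<in> S" for \<sigma>
        by (rule bexI[OF _ K_one]) (simp only: gal_rat[OF SG[OF that] Rats_1] one_neq_zero not_False_eq_True)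
      show "\<exists>x\<in>K. \<sigma> x \<noteq> \<tau> x" if "\<sigma> \<in> S" "\<tau> \<in> S" "\<sigma> \<noteq> \<tau>" for \<sigma> \<tau>
        using that S(2) Gal_eqI[of \<sigma> \<tau>] by blast
      show "\<sigma> (x * y) = \<sigma> x * \<sigma> y" if "\<sigma> \<in> S" "x \<in> K" "y \<in> K" for \<sigma> x y
        using gal_mult[OF SG[OF that(1)] that(2,3)] .
    qed (use S(1) K_mult in blast)+
    with c(1) show False by blast
  qed
  have "finite Gal"
  proof (rule ccontr)
    assume "infinite Gal"
    then obtain S where "finite S" "card S = Suc (card B)" "S \<subseteq> Gal"
      using infinite_arbitrarily_large by blast
    with bound[of S] show False by simp
  qed
  with bound[of Gal] B(3) show ?thesis by simp
qed

lemmas finite_Gal = conjunct1[OF card_Gal]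

lemma card_Gal_pos: "card Gal > 0"
  using restrict_id_in_Gal finite_Gal card_gt_0_iff by blast

text \<open>Left translation is injective since \<open>\<tau>\<close> is injective on
  \<open>K\<close>, and an injective self-map of a finite set is onto. It allows sums and products
  over \<open>Gal\<close> to be reindexed.\<close>

lemma bij_comp_Gal:
  assumes "\<tau> \<in> galois_group K"
  shows "bij_betw (compose K \<tau>) Gal Gal"
proof -
  have "inj_on (compose K \<tau>) Gal"
  proof (rule inj_onI)
    fix \<sigma> \<sigma>' assume *: "\<sigma> \<in> Gal" "\<sigma>' \<in> Gal" "compose K \<tau> \<sigma> = compose K \<tau> \<sigma>'"
    show "\<sigma> = \<sigma>'"
    proof (rule Gal_eqI[OF *(1,2)])
      fix x assume x: "x \<in> K"
      have "\<tau> (\<sigma> x) = \<tau> (\<sigma>' x)" using fun_cong[OF *(3), of x] x by (simp add: compose_eq)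
      then show "\<sigma> x = \<sigma>' x"
        by (rule inj_onD[OF bij_betw_imp_inj_on[OF gal_bij[OF assms]] _
              gal_K[OF GalD[OF *(1)] x] gal_K[OF GalD[OF *(2)] x]])
    qed
  qed
  moreover have "compose K \<tau> ` Gal \<subseteq> Gal" using gal_comp[OF assms] GalD by blast
  ultimately show ?thesis
    using finite_Gal by (simp add: bij_betw_def endo_inj_surj)
qed

section \<open>Norm and trace\<close>

text \<open>This is where the extension being Galois enters; norms and traces are rational because
  of it.\<close>

lemma fixed_imp_Rats:
  assumes "x \<in> K" "\<And>\<sigma>. \<sigma> \<in> galois_group K \<Longrightarrow> \<sigma> x = x"
  shows "x \<in> \<rat>"
  using assms galois unfolding galois_over_rat_def by blast

lemma gal_reindex:
  assumes "\<tau> \<in> galois_group K" "x \<in> K"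
  shows "(\<Prod>\<sigma>\<in>Gal. \<tau> (\<sigma> x)) = Norm x" "(\<Sum>\<sigma>\<in>Gal. \<tau> (\<sigma> x)) = Trace x"
  using prod.reindex_bij_betw[OF bij_comp_Gal[OF assms(1)], of "\<lambda>\<sigma>. \<sigma> x"]
    sum.reindex_bij_betw[OF bij_comp_Gal[OF assms(1)], of "\<lambda>\<sigma>. \<sigma> x"]
  by (simp_all add: Norm_def Trace_def compose_eq[OF assms(2)])

lemma Gal_K: "x \<in> K \<Longrightarrow> \<sigma> \<in> Gal \<Longrightarrow> \<sigma> x \<in> K"
  by (rule gal_K[OF GalD])

lemma Norm_K: "x \<in> K \<Longrightarrow> Norm x \<in> K"
  unfolding Norm_def by (rule K_prod) (rule Gal_K)

lemma Trace_K: "x \<in> K \<Longrightarrow> Trace x \<in> K"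
  unfolding Trace_def by (rule K_sum) (rule Gal_K)

text \<open>Applying an automorphism only permutes the factors of the norm, so the norm is a fixed
  element.\<close>

lemma Norm_Rats:
  assumes x: "x \<in> K"
  shows "Norm x \<in> \<rat>"
proof (rule fixed_imp_Rats[OF Norm_K[OF x]])
  fix \<tau> assume \<tau>: "\<tau> \<in> galois_group K"
  have "\<tau> (Norm x) = (\<Prod>\<sigma>\<in>Gal. \<tau> (\<sigma> x))"
    unfolding Norm_def by (rule gal_prod[OF \<tau>]) (rule Gal_K[OF x])
  then show "\<tau> (Norm x) = Norm x" by (simp only: gal_reindex[OF \<tau> x])
qed

lemma Trace_Rats:
  assumes x: "x \<in> K"
  shows "Trace x \<in> \<rat>"
proof (rule fixed_imp_Rats[OF Trace_K[OF x]])
  fix \<tau> assume \<tau>: "\<tau> \<in> galois_group K"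
  have "\<tau> (Trace x) = (\<Sum>\<sigma>\<in>Gal. \<tau> (\<sigma> x))"
    unfolding Trace_def by (rule gal_sum[OF \<tau>]) (rule Gal_K[OF x])
  then show "\<tau> (Trace x) = Trace x" by (simp only: gal_reindex[OF \<tau> x])
qed

lemma Norm_mult: "x \<in> K \<Longrightarrow> y \<in> K \<Longrightarrow> Norm (x * y) = Norm x * Norm y"
  unfolding Norm_def prod.distrib[symmetric] by (rule prod.cong[OF refl]) (rule gal_mult[OF GalD])

lemma Norm_eq_0_iff:
  assumes "x \<in> K"
  shows "Norm x = 0 \<longleftrightarrow> x = 0"
proof -
  have "\<sigma> x = 0 \<longleftrightarrow> x = 0" if "\<sigma> \<in> Gal" for \<sigma>
    using gal_eq_0_iff[OF GalD[OF that] assms] .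
  then show ?thesis
    unfolding Norm_def prod_zero_iff[OF finite_Gal] using restrict_id_in_Gal by blast
qed

lemma Trace_add: "x \<in> K \<Longrightarrow> y \<in> K \<Longrightarrow> Trace (x + y) = Trace x + Trace y"
  unfolding Trace_def sum.distrib[symmetric] by (rule sum.cong[OF refl]) (rule gal_add[OF GalD])

lemma Trace_sum:
  assumes "\<And>i. i \<in> I \<Longrightarrow> f i \<in> K"
  shows "Trace (sum f I) = (\<Sum>i\<in>I. Trace (f i))"
proof -
  have "(\<Sum>i\<in>I. Trace (f i)) = (\<Sum>\<sigma>\<in>Gal. \<Sum>i\<in>I. \<sigma> (f i))"
    unfolding Trace_def by (rule sum.swap)
  also have "\<dots> = Trace (sum f I)"
    unfolding Trace_def
    by (rule sum.cong[OF refl]) (rule gal_sum[OF GalD assms, symmetric])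
  finally show ?thesis by simp
qed

lemma Trace_rat_scale:
  assumes "x \<in> K"
  shows "Trace (rat_scale q x) = rat_scale q (Trace x)"
proof -
  have "Trace (rat_scale q x) = (\<Sum>\<sigma>\<in>Gal. rat_scale q (\<sigma> x))"
    unfolding Trace_def
    by (rule sum.cong[OF refl]) (rule gal_rat_scale[OF GalD assms])
  then show ?thesis by (simp add: Trace_def rat_scale_def sum_distrib_left)
qed

end

section \<open>Galois-invariant orders with prime conductor\<close>

locale galois_order = galois_number_field K for K :: "'a::field_char_0 set" +
  fixes \<O> :: "'a set"
  assumes order: "is_order K \<O>"
    and invariant: "galois_invariant K \<O>"
    and prime: "primeideal (conductor K \<O>) (ring_on (ring_of_integers K))"
    and units: "Units (ring_on \<O>) = Units (ring_on (ring_of_integers K))"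
    and class_number: "class_number K = 1"
begin

abbreviation OK where "OK \<equiv> ring_of_integers K"

section \<open>Arithmetic of the order and of the ring of integers\<close>

lemma order_basis:
  obtains B where "finite B" "rat_vs.independent B" "rat_vs.span B = K" "\<O> = int_mod.span B"
    "B \<subseteq> \<O>" "\<exists>b\<in>B. b \<noteq> 0"
proof -
  obtain B where B: "rat_vs.independent B" "rat_vs.span B = K" "\<O> = int_mod.span B"
    using order by (auto simp: is_order_def)
  obtain B0 where B0: "finite B0" "rat_vs.span B0 = K" by (rule K_span)
  have "B \<subseteq> rat_vs.span B0" using B0 B rat_vs.span_superset by metis
  then have "finite B" using rat_vs.independent_span_bound[OF B0(1) B(1)] by blast
  moreover have "B \<subseteq> \<O>" using B(3) int_mod.span_superset by metis
  moreover have "\<exists>b\<in>B. b \<noteq> 0"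
  proof (rule ccontr)
    assume "\<not> (\<exists>b\<in>B. b \<noteq> 0)"
    then have "K \<subseteq> rat_vs.span {0}" using B(2) rat_vs.span_mono[of B "{0}"] by blast
    then show False using K_one by (auto simp: rat_vs.span_singleton)
  qed
  ultimately show ?thesis using that B by blast
qed

lemma order_subspace: "int_mod.subspace \<O>"
  using order_basis int_mod.subspace_span by metis

lemma order_zero: "0 \<in> \<O>"
  by (rule int_mod.subspace_0[OF order_subspace])

lemma order_add: "x \<in> \<O> \<Longrightarrow> y \<in> \<O> \<Longrightarrow> x + y \<in> \<O>"
  by (rule int_mod.subspace_add[OF order_subspace])

lemma order_sum: "(\<And>i. i \<in> I \<Longrightarrow> f i \<in> \<O>) \<Longrightarrow> sum f I \<in> \<O>"
  by (rule int_mod.subspace_sum[OF order_subspace])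

lemma order_int_scale: "x \<in> \<O> \<Longrightarrow> of_int z * x \<in> \<O>"
  using int_mod.subspace_scale[OF order_subspace, of x z] by (simp add: int_scale_def)

lemma order_subring: "subring \<O> (ring_on K)"
  using order by (simp add: is_order_def)

lemma order_one: "1 \<in> \<O>"
  using submonoid.one_closed[OF subring.axioms(2)[OF order_subring]] by simp

lemma order_mult: "x \<in> \<O> \<Longrightarrow> y \<in> \<O> \<Longrightarrow> x * y \<in> \<O>"
  using submonoid.m_closed[OF subring.axioms(2)[OF order_subring], of x y] by simp

lemma order_subset_K: "\<O> \<subseteq> K"
  using submonoid.subset[OF subring.axioms(2)[OF order_subring]] by simp

lemma order_of_int: "of_int z \<in> \<O>"
  using order_int_scale[OF order_one, of z] by simp

lemma order_prod: "(\<And>i. i \<in> I \<Longrightarrow> f i \<in> \<O>) \<Longrightarrow> prod f I \<in> \<O>"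
  by (induction I rule: infinite_finite_induct) (auto intro: order_one order_mult)

text \<open>The order is a finitely generated additive group that multiplication by \<open>x\<close>
  maps into itself, so the determinant trick applies.\<close>

lemma order_subset_OK: "\<O> \<subseteq> OK"
proof
  fix x assume x: "x \<in> \<O>"
  obtain B where B: "finite B" "\<O> = int_mod.span B" "B \<subseteq> \<O>" "\<exists>b\<in>B. b \<noteq> 0"
    by (rule order_basis)
  have "algebraic_int x"
  proof (rule algebraic_int_if_stable_span[OF B(1,4)])
    fix b assume "b \<in> B"
    then have "x * b \<in> \<O>" using B(3) x order_mult by blast
    then show "x * b \<in> int_mod.span B" using B(2) by simp
  qed
  then show "x \<in> OK" using x order_subset_K by (auto simp: ring_of_integers_def)
qed

lemma OK_subset_K: "OK \<subseteq> K"
  by (auto simp: ring_of_integers_def)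

text \<open>\<open>primeideal\<close> includes that the surrounding structure is a commutative ring;
  closure of the algebraic integers of \<open>K\<close> under sums and products is read off from
  this.\<close>

lemma OK_cring: "cring (ring_on OK)"
  using prime by (rule primeideal.axioms(2))

lemma OK_mult: "x \<in> OK \<Longrightarrow> y \<in> OK \<Longrightarrow> x * y \<in> OK"
  and OK_add: "x \<in> OK \<Longrightarrow> y \<in> OK \<Longrightarrow> x + y \<in> OK"
proof -
  interpret R: cring "ring_on OK" by (rule OK_cring)
  assume "x \<in> OK" "y \<in> OK"
  then show "x * y \<in> OK" "x + y \<in> OK"
    using R.m_closed[of x y] R.a_closed[of x y] by simp_all
qed

lemma OK_zero: "0 \<in> OK" and OK_one: "1 \<in> OK" and OK_of_int: "of_int z \<in> OK"
  using order_subset_OK order_zero order_one order_of_int by blast+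

lemma OK_sum: "(\<And>i. i \<in> I \<Longrightarrow> f i \<in> OK) \<Longrightarrow> sum f I \<in> OK"
  by (induction I rule: infinite_finite_induct) (auto intro: OK_zero OK_add)

lemma OK_prod: "(\<And>i. i \<in> I \<Longrightarrow> f i \<in> OK) \<Longrightarrow> prod f I \<in> OK"
  by (induction I rule: infinite_finite_induct) (auto intro: OK_one OK_mult)

lemma Gal_OK:
  assumes "x \<in> OK" "\<sigma> \<in> Gal"
  shows "\<sigma> x \<in> OK"
proof -
  from assms(1) have x: "x \<in> K" "algebraic_int x" by (simp_all add: ring_of_integers_def)
  show ?thesis
    unfolding ring_of_integers_def mem_Collect_eq
    by (rule conjI[OF Gal_K[OF x(1) assms(2)] gal_algebraic_int[OF GalD[OF assms(2)] x]])
qed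

lemma gal_order: "\<sigma> \<in> galois_group K \<Longrightarrow> x \<in> \<O> \<Longrightarrow> \<sigma> x \<in> \<O>"
  by (rule invariant[unfolded galois_invariant_def, rule_format])

lemma OK_Rats_imp_Ints: "x \<in> OK \<Longrightarrow> x \<in> \<rat> \<Longrightarrow> x \<in> \<int>"
  unfolding ring_of_integers_def by (blast intro: rational_algebraic_int_is_int)

lemma Norm_Ints:
  assumes "x \<in> OK"
  shows "Norm x \<in> \<int>"
proof (rule OK_Rats_imp_Ints)
  show "Norm x \<in> OK" unfolding Norm_def by (rule OK_prod) (rule Gal_OK[OF assms])
  show "Norm x \<in> \<rat>" using assms OK_subset_K by (intro Norm_Rats) blast
qed

lemma Trace_Ints:
  assumes "x \<in> OK"
  shows "Trace x \<in> \<int>"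
proof (rule OK_Rats_imp_Ints)
  show "Trace x \<in> OK" unfolding Trace_def by (rule OK_sum) (rule Gal_OK[OF assms])
  show "Trace x \<in> \<rat>" using assms OK_subset_K by (intro Trace_Rats) blast
qed

section \<open>The trace form and a nonzero conductor\<close>

text \<open>By linearity \<open>y\<close> is orthogonal to all of \<open>K\<close>, in particular to
  its inverse if \<open>y \<noteq> 0\<close>. But \<open>Trace 1\<close> is the order of the Galois
  group, nonzero in characteristic 0.\<close>

lemma Trace_nondegenerate:
  assumes B: "rat_vs.span B = K" and y: "y \<in> K" "\<And>b. b \<in> B \<Longrightarrow> Trace (y * b) = 0"
  shows "y = 0"
proof (rule ccontr)
  assume "y \<noteq> 0"
  have zero: "z \<in> K \<and> Trace (y * z) = 0" if "z \<in> K" for z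
  proof -
    have "z \<in> rat_vs.span B" using B that by simp
    then show ?thesis
    proof (rule rat_vs.span_induct)
      show "rat_vs.subspace {z. z \<in> K \<and> Trace (y * z) = 0}"
      proof (intro rat_vs.subspaceI CollectI conjI; (elim CollectE conjE)?)
        have "Trace (rat_scale 0 0) = rat_scale 0 (Trace 0)" by (rule Trace_rat_scale[OF K_zero])
        then show "Trace (y * 0) = 0" by (simp add: rat_scale_def)
        fix u assume u: "u \<in> K" "Trace (y * u) = 0"
        fix q
        show "rat_scale q u \<in> K" by (rule rat_vs.subspace_scale[OF K_subspace u(1)])
        have "y * rat_scale q u = rat_scale q (y * u)" by (simp add: rat_scale_def)
        then show "Trace (y * rat_scale q u) = 0"
          using Trace_rat_scale[OF K_mult[OF y(1) u(1)], of q] u(2) by (simp only: rat_scale_def) simp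
        fix v assume v: "v \<in> K" "Trace (y * v) = 0"
        show "u + v \<in> K" by (rule K_add[OF u(1) v(1)])
        show "Trace (y * (u + v)) = 0"
          using Trace_add[OF K_mult[OF y(1) u(1)] K_mult[OF y(1) v(1)]] u(2) v(2)
          by (simp add: distrib_left)
      qed (rule K_zero)
      show "z \<in> K \<and> Trace (y * z) = 0" if "z \<in> B" for z
        using y(2)[OF that] rat_vs.span_base[OF that] B by blast
    qed
  qed
  have "Trace 1 = of_nat (card Gal)"
  proof -
    have "Trace 1 = (\<Sum>\<sigma>\<in>Gal. 1)"
      unfolding Trace_def by (rule sum.cong[OF refl]) (rule gal_rat[OF GalD Rats_1])
    then show ?thesis by simp
  qed
  moreover have "Trace 1 = 0"
    using zero[OF K_inverse[OF y(1)]] \<open>y \<noteq> 0\<close> by simp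
  ultimately show False using card_Gal_pos by simp
qed

text \<open>The coordinates of \<open>y\<close> and a common scale of the right-hand sides are
  \<open>card B + 1\<close> unknowns in \<open>card B\<close> equations. A solution with scale 0
  would have \<open>y = 0\<close> by nondegeneracy, hence be trivial by independence of
  \<open>B\<close>; otherwise the scale can be divided out.\<close>

lemma dual_basis:
  assumes B: "finite B" "rat_vs.independent B" "rat_vs.span B = K" and b0: "b0 \<in> B"
  shows "\<exists>y\<in>K. \<forall>b\<in>B. Trace (y * b) = (if b = b0 then 1 else 0)"
proof -
  have BK: "b \<in> K" if "b \<in> B" for b using rat_vs.span_base[OF that] B(3) by simp
  have "\<exists>q. b \<in> B \<longrightarrow> b' \<in> B \<longrightarrow> Trace (b * b') = of_rat q" for b b'
  proof (cases "b \<in> B \<and> b' \<in> B")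
    case True
    then have "Trace (b * b') \<in> \<rat>" using BK by (intro Trace_Rats K_mult) auto
    then show ?thesis by (auto simp: Rats_def)
  qed auto
  then obtain t where t: "\<And>b b'. b \<in> B \<Longrightarrow> b' \<in> B \<Longrightarrow> Trace (b * b') = of_rat (t b b')"
    by metis
  \<comment> \<open>\<open>None\<close> indexes the scale, moved to the left-hand side of the
    equation for \<open>b0\<close> with coefficient -1.\<close>
  define a where "a i b' = (case i of Some b \<Rightarrow> t b b' | None \<Rightarrow> if b' = b0 then - 1 else 0)" for i b'
  have "card B < card (insert None (Some ` B))"
    using B(1) by (simp add: card_image)
  from exists_nontrivial_solution[OF B(1) _ this, of a] B(1) obtain c where
    c: "\<exists>i\<in>insert None (Some ` B). c i \<noteq> 0"
       "\<And>b'. b' \<in> B \<Longrightarrow> (\<Sum>i\<in>insert None (Some ` B). c i * a i b') = 0" by auto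
  have c': "(\<Sum>b\<in>B. c (Some b) * t b b') = (if b' = b0 then c None else 0)" if "b' \<in> B" for b'
    using c(2)[OF that] B(1) by (simp add: sum.reindex a_def add_eq_0_iff split: if_splits)
  define y where "y = (\<Sum>b\<in>B. rat_scale (c (Some b)) b)"
  have yK: "y \<in> K" unfolding y_def
    by (intro K_sum rat_vs.subspace_scale[OF K_subspace] BK)
  have tr: "Trace (y * b') = (if b' = b0 then of_rat (c None) else 0)" if b': "b' \<in> B" for b'
  proof -
    have "y * b' = (\<Sum>b\<in>B. rat_scale (c (Some b)) (b * b'))"
      by (simp add: y_def rat_scale_def sum_distrib_right mult.assoc)
    also have "Trace \<dots> = (\<Sum>b\<in>B. Trace (rat_scale (c (Some b)) (b * b')))"
      by (intro Trace_sum rat_vs.subspace_scale[OF K_subspace] K_mult BK b')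
    also have "\<dots> = (\<Sum>b\<in>B. of_rat (c (Some b) * t b b'))"
      by (rule sum.cong[OF refl], subst Trace_rat_scale)
         (auto intro!: K_mult dest: BK simp: rat_scale_def t b' BK[OF b'] of_rat_mult)
    also have "\<dots> = of_rat (if b' = b0 then c None else 0)"
      unfolding of_rat_sum[symmetric] c'[OF b'] ..
    finally show ?thesis by simp
  qed
  have "c None \<noteq> 0"
  proof
    assume 0: "c None = 0"
    have "y = 0" by (rule Trace_nondegenerate[OF B(3) yK]) (simp add: tr 0)
    then have "\<forall>b\<in>B. c (Some b) = 0"
      using rat_vs.independentD[OF B(2,1) subset_refl, of "\<lambda>b. c (Some b)"]
      unfolding y_def by blast
    with c(1) 0 show False by auto
  qed
  moreover have "Trace (rat_scale (1 / c None) y * b) = rat_scale (1 / c None) (Trace (y * b))"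
    if "b \<in> B" for b
    using Trace_rat_scale[OF K_mult[OF yK BK[OF that]], of "1 / c None"]
    by (simp add: rat_scale_def mult.assoc)
  ultimately show ?thesis
    by (intro bexI[of _ "rat_scale (1 / c None) y"] rat_vs.subspace_scale[OF K_subspace yK])
       (auto simp: tr rat_scale_def of_rat_divide)
qed

text \<open>Elements with a nonzero integer multiple in the order form a rational subspace, and it
  contains a basis of \<open>K\<close>.\<close>

lemma common_denominator:
  assumes "y \<in> K"
  shows "\<exists>d::int. d \<noteq> 0 \<and> of_int d * y \<in> \<O>"
proof -
  obtain B where B: "rat_vs.span B = K" "B \<subseteq> \<O>" by (rule order_basis)
  have "y \<in> rat_vs.span B" using assms B by simp
  then show ?thesis
  proof (rule rat_vs.span_induct)
    show "rat_vs.subspace {y. \<exists>d::int. d \<noteq> 0 \<and> of_int d * y \<in> \<O>}"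
    proof (intro rat_vs.subspaceI CollectI; (elim CollectE exE conjE)?)
      show "\<exists>d::int. d \<noteq> 0 \<and> of_int d * 0 \<in> \<O>" using order_zero by (intro exI[of _ 1]) simp
    next
      fix x y :: 'a and d e :: int
      assume d: "d \<noteq> 0" "of_int d * x \<in> \<O>" and e: "e \<noteq> 0" "of_int e * y \<in> \<O>"
      have "of_int e * (of_int d * x) + of_int d * (of_int e * y) \<in> \<O>"
        by (rule order_add[OF order_int_scale[OF d(2)] order_int_scale[OF e(2)]])
      then show "\<exists>d::int. d \<noteq> 0 \<and> of_int d * (x + y) \<in> \<O>"
        using d e by (intro exI[of _ "d * e"]) (simp add: algebra_simps)
    next
      fix q and x :: 'a and d :: int
      assume d: "d \<noteq> 0" "of_int d * x \<in> \<O>"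
      obtain m n where q: "q = Rat.Fract m n" "n > 0" by (cases q) auto
      have "of_int m * (of_int d * x) \<in> \<O>" by (rule order_int_scale[OF d(2)])
      moreover have "of_int m * (of_int d * x) = of_int (n * d) * rat_scale q x"
        using q by (simp add: rat_scale_def Fract_of_int_quotient of_rat_divide)
      ultimately show "\<exists>d::int. d \<noteq> 0 \<and> of_int d * rat_scale q x \<in> \<O>"
        using d q by (intro exI[of _ "n * d"]) simp
    qed
    show "\<exists>d::int. d \<noteq> 0 \<and> of_int d * x \<in> \<O>" if "x \<in> B" for x
      using that B by (intro exI[of _ 1]) auto
  qed
qed

text \<open>Every \<open>x\<close> is the sum of \<open>Trace (x * b)\<close> times the dual vector
  \<open>y b\<close>. For an algebraic integer \<open>x\<close> these traces are integers, so one
  \<open>d\<close> clearing the denominators of the finitely many dual vectors sends all of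
  \<open>OK\<close> into the order.\<close>

lemma conductor_nonzero: "\<exists>d::int. d \<noteq> 0 \<and> of_int d \<in> conductor K \<O>"
proof -
  obtain B where B: "finite B" "rat_vs.independent B" "rat_vs.span B = K" "B \<subseteq> \<O>"
    by (rule order_basis)
  have BK: "b \<in> K" if "b \<in> B" for b using B(4) order_subset_K that by blast
  from dual_basis[OF B(1-3)] obtain y where y: "\<And>b0. b0 \<in> B \<Longrightarrow> y b0 \<in> K"
    "\<And>b0 b. b0 \<in> B \<Longrightarrow> b \<in> B \<Longrightarrow> Trace (y b0 * b) = (if b = b0 then 1 else 0)"
    by metis
  from common_denominator[OF y(1)] obtain e :: "'a \<Rightarrow> int"
    where e: "\<And>b. b \<in> B \<Longrightarrow> e b \<noteq> 0" "\<And>b. b \<in> B \<Longrightarrow> of_int (e b) * y b \<in> \<O>" by metis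
  define d where "d = (\<Prod>b\<in>B. e b)"
  have dy: "of_int d * y b \<in> \<O>" if "b \<in> B" for b
  proof -
    have "of_int d * y b = of_int (\<Prod>b\<in>B - {b}. e b) * (of_int (e b) * y b)"
      unfolding d_def prod.remove[OF B(1) that] by simp
    then show ?thesis using order_int_scale[OF e(2)[OF that]] by (simp only:)
  qed
  have "of_int d * x \<in> \<O>" if x: "x \<in> OK" for x
  proof -
    have xK: "x \<in> K" using x OK_subset_K by blast
    have "\<exists>z::int. Trace (x * b) = of_int z" if "b \<in> B" for b
      using Trace_Ints[of "x * b"] OK_mult[OF x, of b] that B(4) order_subset_OK
      by (auto elim!: Ints_cases)
    then obtain z where z: "\<And>b. b \<in> B \<Longrightarrow> Trace (x * b) = of_int (z b)" by metis
    define s where "s = (\<Sum>b\<in>B. rat_scale (of_int (z b)) (y b))"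
    have sK: "s \<in> K" unfolding s_def by (intro K_sum rat_vs.subspace_scale[OF K_subspace] y)
    \<comment> \<open>\<open>s\<close> has the same traces against \<open>B\<close> as
      \<open>x\<close>, so nondegeneracy identifies them.\<close>
    have "x - s = 0"
    proof (rule Trace_nondegenerate[OF B(3)])
      show xs: "x - s \<in> K" using rat_vs.subspace_diff[OF K_subspace xK sK] .
      fix b assume b: "b \<in> B"
      have "s * b = (\<Sum>b'\<in>B. rat_scale (of_int (z b')) (y b' * b))"
        by (simp add: s_def rat_scale_def sum_distrib_right mult.assoc)
      also have "Trace \<dots> = (\<Sum>b'\<in>B. Trace (rat_scale (of_int (z b')) (y b' * b)))"
        by (intro Trace_sum rat_vs.subspace_scale[OF K_subspace] K_mult BK b y)
      also have "\<dots> = (\<Sum>b'\<in>B. if b = b' then of_int (z b') else 0)"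
        by (rule sum.cong[OF refl], subst Trace_rat_scale)
           (auto intro!: K_mult y(1) simp: rat_scale_def y(2) b BK[OF b])
      also have "\<dots> = of_int (z b)" using B(1) b by simp
      finally have "Trace (s * b) = of_int (z b)" .
      moreover have "Trace (x * b) = Trace ((x - s) * b) + Trace (s * b)"
        using Trace_add[OF K_mult[OF xs BK[OF b]] K_mult[OF sK BK[OF b]]]
        by (simp add: left_diff_distrib)
      ultimately show "Trace ((x - s) * b) = 0" using z[OF b] by simp
    qed
    then have "of_int d * x = (\<Sum>b\<in>B. of_int (z b) * (of_int d * y b))"
      by (simp add: s_def rat_scale_def sum_distrib_left mult.left_commute)
    then show ?thesis using order_sum[of B, OF order_int_scale[OF dy]] by simp
  qed
  moreover have "d \<noteq> 0" using B(1) e(1) by (simp add: d_def)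
  ultimately show ?thesis
    by (intro exI[of _ d]) (simp add: conductor_def OK_of_int)
qed

lemma conductor_subset_order: "conductor K \<O> \<subseteq> \<O>"
proof
  fix x assume "x \<in> conductor K \<O>"
  then have "x * 1 \<in> \<O>" using OK_one unfolding conductor_def by blast
  then show "x \<in> \<O>" by simp
qed

section \<open>Class number one: principal ideals and unique factorization\<close>

text \<open>\<open>OK\<close> and \<open>I\<close> have the same class, the only one there is.
  Reflexivity at \<open>I\<close> puts \<open>I\<close> into it, so \<open>I\<close> is related to
  \<open>OK\<close> by a scalar.\<close>

lemma fractional_ideal_principal:
  assumes "fractional_ideal K I"
  shows "\<exists>c\<in>K. c \<noteq> 0 \<and> I = (*) c ` OK"
proof -
  have OK: "fractional_ideal K OK"
    unfolding fractional_ideal_def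
  proof (intro conjI ballI)
    show "OK \<noteq> {0}" using OK_one by auto
    show "\<exists>d\<in>OK. d \<noteq> 0 \<and> (\<forall>x\<in>OK. d * x \<in> OK)"
      by (rule bexI[OF _ OK_one]) simp
  qed (use OK_subset_K OK_zero OK_add OK_mult in blast)+
  have refl: "(J, J) \<in> ideal_class_rel K" if "fractional_ideal K J" for J
    unfolding ideal_class_rel_def mem_Collect_eq case_prod_conv
    by (intro conjI that bexI[OF _ K_one]) simp_all
  obtain C where C: "{I. fractional_ideal K I} // ideal_class_rel K = {C}"
    using class_number unfolding class_number_def by (rule card_1_singletonE)
  have "ideal_class_rel K `` {J} = C" if "fractional_ideal K J" for J
    using quotientI[of J "{I. fractional_ideal K I}" "ideal_class_rel K"] that unfolding C by simp
  from this[OF OK] this[OF assms] have "ideal_class_rel K `` {OK} = ideal_class_rel K `` {I}"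
    by simp
  then have "I \<in> ideal_class_rel K `` {OK}" using refl[OF assms] by (simp only: Image_singleton_iff)
  then have "(OK, I) \<in> ideal_class_rel K" by (simp only: Image_singleton_iff)
  then show ?thesis by (simp add: ideal_class_rel_def)
qed

text \<open>Every ideal is principal, so an irreducible \<open>a\<close> and any \<open>x\<close> have a greatest common
  divisor that is a linear combination of them.\<close>

lemma irreducible_imp_prime:
  assumes a: "a \<in> Irr OK" and xy: "x \<in> OK" "y \<in> OK" "z \<in> OK" "x * y = a * z"
  shows "(\<exists>w\<in>OK. x = a * w) \<or> (\<exists>w\<in>OK. y = a * w)"
proof -
  define I where "I = {a * r + x * s |r s. r \<in> OK \<and> s \<in> OK}"
  have aOK: "a \<in> OK" "a \<noteq> 0" using IrrD[OF a] by blast+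
  have I_OK: "I \<subseteq> OK" using aOK xy by (auto simp: I_def intro!: OK_add OK_mult)
  have mem: "a * r + x * s \<in> I" if "r \<in> OK" "s \<in> OK" for r s using that by (auto simp: I_def)
  have aI: "a \<in> I" and xI: "x \<in> I"
    using mem[OF OK_one OK_zero] mem[OF OK_zero OK_one] by simp_all
  have "fractional_ideal K I"
    unfolding fractional_ideal_def
  proof (intro conjI ballI)
    show "I \<subseteq> K" using I_OK OK_subset_K by blast
    show "0 \<in> I" using mem[OF OK_zero OK_zero] by simp
    show "I \<noteq> {0}" using aI aOK by blast
    show "\<exists>d\<in>OK. d \<noteq> 0 \<and> (\<forall>x\<in>I. d * x \<in> OK)" using I_OK OK_one by (intro bexI[of _ 1]) auto
  next
    fix u v assume "u \<in> I" "v \<in> I"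
    then obtain r s r' s' where uv: "u = a * r + x * s" "v = a * r' + x * s'"
      "r \<in> OK" "s \<in> OK" "r' \<in> OK" "s' \<in> OK" by (auto simp: I_def)
    then show "u + v \<in> I"
      using mem[OF OK_add[OF uv(3,5)] OK_add[OF uv(4,6)]] by (simp add: algebra_simps)
  next
    fix b u assume b: "b \<in> OK" and "u \<in> I"
    then obtain r s where u: "u = a * r + x * s" "r \<in> OK" "s \<in> OK" by (auto simp: I_def)
    then show "b * u \<in> I"
      using mem[OF OK_mult[OF b u(2)] OK_mult[OF b u(3)]] by (simp add: algebra_simps)
  qed
  then obtain c where c: "I = (*) c ` OK" using fractional_ideal_principal by blast
  have cI: "c \<in> I" unfolding c by (rule image_eqI[OF _ OK_one]) simp
  then have cOK: "c \<in> OK" using I_OK by blast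
  obtain e where e: "e \<in> OK" "a = c * e" using aI c by auto
  obtain f where f: "f \<in> OK" "x = c * f" using xI c by auto
  \<comment> \<open>If \<open>c\<close> is a unit, a Bezout combination multiplied by
    \<open>y\<close> shows that \<open>a\<close> divides \<open>y\<close>; if \<open>e\<close> is
    one, \<open>a\<close> is associated to \<open>c\<close>, a divisor of \<open>x\<close>.\<close>
  have "c \<in> Units (ring_on OK) \<or> e \<in> Units (ring_on OK)"
    using a e cOK unfolding mem_Irr_iff by blast
  then show ?thesis
  proof
    assume "c \<in> Units (ring_on OK)"
    then obtain d where d: "d \<in> OK" "c * d = 1" by (auto simp: mem_Units_ring_on)
    obtain r s where rs: "c = a * r + x * s" "r \<in> OK" "s \<in> OK" using cI by (auto simp: I_def)
    have "y = (c * d) * y" using d by simp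
    also have "\<dots> = (a * r + x * s) * d * y" using rs(1) by (simp only:)
    also have "\<dots> = a * (r * y * d) + (x * y) * (s * d)" by (simp add: algebra_simps)
    also have "\<dots> = a * (r * y * d + z * (s * d))" by (simp only: xy(4)) (simp add: algebra_simps)
    finally show ?thesis using rs d xy by (blast intro: OK_add OK_mult)
  next
    assume "e \<in> Units (ring_on OK)"
    then obtain d where d: "d \<in> OK" "e * d = 1" by (auto simp: mem_Units_ring_on)
    have "x = c * (e * d) * f" using f d by simp
    also have "\<dots> = a * (d * f)" using e by (simp add: algebra_simps)
    finally show ?thesis using d f by (blast intro: OK_mult)
  qed
qed

text \<open>Unique factorization in the form used below. Irreducibles are prime, so each factor
  \<open>f i\<close> can be cancelled from \<open>x\<close> or from \<open>y\<close>;
  \<open>J\<close> collects those cancelled from \<open>x\<close>.\<close>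

lemma divisor_of_irreducible_product:
  assumes "finite A" "\<And>i. i \<in> A \<Longrightarrow> f i \<in> Irr OK"
    and "x \<in> OK" "y \<in> OK" "x * y = (\<Prod>i\<in>A. f i)"
  shows "\<exists>J\<subseteq>A. \<exists>u\<in>Units (ring_on OK). x = u * (\<Prod>i\<in>J. f i)"
  using assms
proof (induction A arbitrary: x y rule: finite_induct)
  case empty
  then show ?case by (auto simp: mem_Units_ring_on)
next
  case (insert i A)
  have fi: "f i \<in> Irr OK" "f i \<noteq> 0" and fA: "\<And>j. j \<in> A \<Longrightarrow> f j \<in> Irr OK"
    using insert.prems(1) IrrD(2)[of "f i" OK] by simp_all
  have prod: "(\<Prod>j\<in>A. f j) \<in> OK" by (rule OK_prod) (rule IrrD(1)[OF fA])
  have xy: "x * y = f i * (\<Prod>j\<in>A. f j)" using insert by simp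
  from irreducible_imp_prime[OF fi(1) insert.prems(2,3) prod xy] show ?case
  proof (elim disjE bexE)
    fix w assume w: "w \<in> OK" "x = f i * w"
    then have "w * y = (\<Prod>j\<in>A. f j)" using xy fi(2) by (simp add: mult.assoc)
    from insert.IH[OF fA w(1) insert.prems(3) this] obtain J u
      where J: "J \<subseteq> A" "u \<in> Units (ring_on OK)" "w = u * (\<Prod>j\<in>J. f j)" by blast
    have "(\<Prod>j\<in>insert i J. f j) = f i * (\<Prod>j\<in>J. f j)"
      using J(1) insert.hyps by (intro prod.insert) (auto intro: finite_subset)
    then have "x = u * (\<Prod>j\<in>insert i J. f j)" using w(2) J(3) by (simp add: mult.left_commute)
    then show ?thesis using J by blast
  next
    fix w assume w: "w \<in> OK" "y = f i * w"
    then have "x * w = (\<Prod>j\<in>A. f j)" using xy fi(2) by (simp add: mult.left_commute)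
    from insert.IH[OF fA insert.prems(2) w(1) this] show ?thesis by blast
  qed
qed

section \<open>Irreducible elements of the order inside the conductor\<close>

text \<open>The nonzero integer of \<open>conductor_nonzero\<close> is what makes the conductor a
  fractional ideal.\<close>

lemma conductor_generator:
  obtains p where "p \<noteq> 0" "conductor K \<O> = (*) p ` OK"
proof -
  interpret P: primeideal "conductor K \<O>" "ring_on OK" by (rule prime)
  have sub: "conductor K \<O> \<subseteq> OK" by (auto simp: conductor_def)
  have add: "x + y \<in> conductor K \<O>" if "x \<in> conductor K \<O>" "y \<in> conductor K \<O>" for x y
    using additive_subgroup.a_closed[OF P.additive_subgroup_axioms that] by simp
  have mult: "a * x \<in> conductor K \<O>" if "a \<in> OK" "x \<in> conductor K \<O>" for a x
    using P.I_l_closed[of x a] that by simp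
  have "fractional_ideal K (conductor K \<O>)"
    unfolding fractional_ideal_def
  proof (intro conjI ballI)
    show "conductor K \<O> \<subseteq> K" using sub OK_subset_K by blast
    obtain d :: int where d: "d \<noteq> 0" "of_int d \<in> conductor K \<O>"
      using conductor_nonzero by blast
    show "0 \<in> conductor K \<O>" using mult[OF OK_zero d(2)] by simp
    have "(of_int d :: 'a) \<noteq> 0" using d by simp
    then show "conductor K \<O> \<noteq> {0}" using d(2) by blast
    show "\<exists>d\<in>OK. d \<noteq> 0 \<and> (\<forall>x\<in>conductor K \<O>. d * x \<in> OK)"
      using sub OK_one by (intro bexI[of _ 1]) auto
  qed (use add mult in blast)+
  then show ?thesis using fractional_ideal_principal that by blast
qed

lemma Units_subset_order: "Units (ring_on OK) \<subseteq> \<O>"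
  using units by (auto simp: mem_Units_ring_on)

text \<open>If \<open>p * \<alpha> = b * c\<close> in \<open>\<O>\<close> with \<open>p\<close> dividing \<open>b\<close>, then \<open>c\<close> is, up to a unit, a
  subproduct of \<open>\<alpha>\<close> lying in \<open>\<O>\<close>, hence empty.\<close>

lemma conductor_times_product_irreducible:
  assumes p: "p \<noteq> 0" "conductor K \<O> = (*) p ` OK"
    and A: "finite A" "\<And>i. i \<in> A \<Longrightarrow> f i \<in> Irr OK"
    and no_sub: "\<And>J. J \<noteq> {} \<Longrightarrow> J \<subseteq> A \<Longrightarrow> (\<Prod>i\<in>J. f i) \<notin> \<O>"
  shows "p * (\<Prod>i\<in>A. f i) \<in> Irr \<O>"
proof -
  interpret P: primeideal "conductor K \<O>" "ring_on OK" by (rule prime)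
  define \<alpha> where "\<alpha> = (\<Prod>i\<in>A. f i)"
  have f: "f i \<in> OK" "f i \<noteq> 0" if "i \<in> A" for i
    using IrrD[OF A(2)[OF that]] by blast+
  have \<alpha>: "\<alpha> \<in> OK" "\<alpha> \<noteq> 0" using f A(1) by (auto simp: \<alpha>_def intro: OK_prod)
  have p\<alpha>: "p * \<alpha> \<in> conductor K \<O>" using p(2) \<alpha>(1) by blast
  have pOK: "p \<in> OK"
    using p(2) OK_one image_eqI[of p "(*) p" 1 OK] by (auto simp: conductor_def)
  have unit: "c \<in> Units (ring_on \<O>)"
    if bc: "b \<in> \<O>" "c \<in> \<O>" "p * \<alpha> = b * c" "b \<in> conductor K \<O>" for b c
  proof -
    obtain b' where b': "b' \<in> OK" "b = p * b'" using bc(4) p(2) by auto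
    have "p * (c * b') = b * c" unfolding b'(2) by (simp only: ac_simps)
    also note bc(3)[symmetric]
    finally have "p * (c * b') = p * \<alpha>" .
    then have "c * b' = (\<Prod>i\<in>A. f i)" using p(1) by (simp add: \<alpha>_def)
    moreover have "c \<in> OK" using bc(2) order_subset_OK by blast
    ultimately obtain J u where J: "J \<subseteq> A" "u \<in> Units (ring_on OK)" "c = u * (\<Prod>i\<in>J. f i)"
      using divisor_of_irreducible_product[of A f c b'] A b'(1) by blast
    obtain v where v: "v \<in> OK" "u * v = 1" using J(2) by (auto simp: mem_Units_ring_on)
    then have "v \<in> Units (ring_on OK)"
      using J(2) by (auto simp: mem_Units_ring_on mult.commute intro!: bexI[of _ u])
    \<comment> \<open>Equality of the unit groups: the unit \<open>u\<close> can be removed from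
      \<open>c\<close> without leaving the order.\<close>
    then have "v \<in> \<O>" using Units_subset_order by blast
    then have "v * c \<in> \<O>" using bc(2) by (rule order_mult)
    moreover have "v * c = (u * v) * (\<Prod>i\<in>J. f i)" using J(3) by (simp add: ac_simps)
    ultimately have "(\<Prod>i\<in>J. f i) \<in> \<O>" using v(2) by simp
    then have "J = {}" using no_sub[of J] J(1) by blast
    then show ?thesis using J units by simp
  qed
  have nonunit: "p * \<alpha> \<notin> Units (ring_on \<O>)"
  proof
    assume "p * \<alpha> \<in> Units (ring_on \<O>)"
    then obtain y where y: "y \<in> OK" "p * \<alpha> * y = 1" unfolding units mem_Units_ring_on by blast
    \<comment> \<open>A unit in the conductor would make it all of \<open>OK\<close>, but prime
      ideals are proper.\<close>
    then have "1 \<in> conductor K \<O>" using P.I_r_closed[OF p\<alpha>, of y] by simp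
    then have "x \<in> conductor K \<O>" if "x \<in> OK" for x
      using P.I_l_closed[of 1 x] that by simp
    moreover have "conductor K \<O> \<subseteq> OK" by (auto simp: conductor_def)
    ultimately show False using P.I_notcarr by auto
  qed
  have "b \<in> Units (ring_on \<O>) \<or> c \<in> Units (ring_on \<O>)"
    if bc: "b \<in> \<O>" "c \<in> \<O>" "p * \<alpha> = b * c" for b c
  proof -
    \<comment> \<open>Primality of the conductor puts one factor into it; by \<open>unit\<close>,
      the other factor is then a unit.\<close>
    have "b \<in> conductor K \<O> \<or> c \<in> conductor K \<O>"
      using P.I_prime[of b c] p\<alpha> bc order_subset_OK by auto
    then show ?thesis using unit[OF bc] unit[of c b] bc by (auto simp: mult.commute)
  qed
  then show ?thesis
    unfolding mem_Irr_iff \<alpha>_def[symmetric]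
    using conductor_subset_order p\<alpha> nonunit mult_eq_0_iff[of p \<alpha>] p(1) \<alpha>(2) by blast
qed

section \<open>Conjugates, norms and atomicity of the order\<close>

lemma gal_unit:
  assumes "\<sigma> \<in> galois_group K" "x \<in> Units (ring_on \<O>)"
  shows "\<sigma> x \<in> Units (ring_on \<O>)"
proof -
  obtain y where y: "x \<in> \<O>" "y \<in> \<O>" "x * y = 1"
    using assms(2) by (auto simp: mem_Units_ring_on)
  have xK: "x \<in> K" "y \<in> K" using y order_subset_K by blast+
  have "\<sigma> x * \<sigma> y = 1"
    using gal_mult[OF assms(1) xK] gal_rat[OF assms(1) Rats_1] y(3) by simp
  then show ?thesis
    using gal_order[OF assms(1) y(1)] gal_order[OF assms(1) y(2)]
    unfolding mem_Units_ring_on by blast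
qed

text \<open>Invariance applies to \<open>\<sigma>\<close> and to its inverse, so a factorization of
  \<open>\<sigma> a\<close> in the order pulls back to one of \<open>a\<close>, and units correspond
  to units.\<close>

lemma gal_Irr:
  assumes \<sigma>: "\<sigma> \<in> galois_group K" and a: "a \<in> Irr \<O>"
  shows "\<sigma> a \<in> Irr \<O>"
proof -
  define \<tau> where "\<tau> = inv_into K \<sigma>"
  have \<tau>: "\<tau> \<in> galois_group K" unfolding \<tau>_def by (rule gal_inv[OF \<sigma>])
  have inv: "\<sigma> (\<tau> x) = x" "\<tau> (\<sigma> x) = x" if "x \<in> K" for x
    using bij_betw_inv_into_right[OF gal_bij[OF \<sigma>] that]
      bij_betw_inv_into_left[OF gal_bij[OF \<sigma>] that] by (simp_all only: \<tau>_def)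
  have aO: "a \<in> \<O>" "a \<noteq> 0" "a \<notin> Units (ring_on \<O>)" by (rule IrrD[OF a])+
  have aK: "a \<in> K" using aO order_subset_K by blast
  have "\<sigma> a \<notin> Units (ring_on \<O>)"
    using gal_unit[OF \<tau>, of "\<sigma> a"] aO(3) inv(2)[OF aK] by auto
  moreover have "\<sigma> a \<noteq> 0" using gal_eq_0_iff[OF \<sigma> aK] aO(2) by blast
  moreover have "b \<in> Units (ring_on \<O>) \<or> c \<in> Units (ring_on \<O>)"
    if bc: "b \<in> \<O>" "c \<in> \<O>" "\<sigma> a = b * c" for b c
  proof -
    have bcK: "b \<in> K" "c \<in> K" using bc order_subset_K by blast+
    have "a = \<tau> b * \<tau> c" using inv(2)[OF aK] gal_mult[OF \<tau> bcK] bc(3) by simp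
    then have "\<tau> b \<in> Units (ring_on \<O>) \<or> \<tau> c \<in> Units (ring_on \<O>)"
      using a gal_order[OF \<tau> bc(1)] gal_order[OF \<tau> bc(2)] unfolding mem_Irr_iff by blast
    then show ?thesis
      using gal_unit[OF \<sigma>, of "\<tau> b"] gal_unit[OF \<sigma>, of "\<tau> c"] inv(1)[OF bcK(1)] inv(1)[OF bcK(2)]
      by auto
  qed
  ultimately show ?thesis using gal_order[OF \<sigma> aO(1)] unfolding mem_Irr_iff by blast
qed

text \<open>\<open>restrict id K\<close> is the identity of \<open>Gal\<close>. The cofactor of
  \<open>x\<close> is a product of conjugates, hence stays in the order or in \<open>OK\<close>
  along with \<open>x\<close>.\<close>

lemma Norm_multiple:
  assumes "x \<in> K"
  shows "Norm x = x * (\<Prod>\<sigma>\<in>Gal - {restrict id K}. \<sigma> x)"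
  unfolding Norm_def prod.remove[OF finite_Gal restrict_id_in_Gal] using assms by simp

text \<open>The inverse of \<open>x\<close> is \<open>m\<close> times the product of its other
  conjugates, which lies in the order by invariance.\<close>

lemma abs_Norm_one_imp_unit:
  assumes x: "x \<in> \<O>" and m: "Norm x = of_int m" "\<bar>m\<bar> = 1"
  shows "x \<in> Units (ring_on \<O>)"
proof -
  define y where "y = (\<Prod>\<sigma>\<in>Gal - {restrict id K}. \<sigma> x)"
  have "\<sigma> x \<in> \<O>" if "\<sigma> \<in> Gal - {restrict id K}" for \<sigma>
    using gal_order[OF GalD x] that by blast
  then have y: "y \<in> \<O>" unfolding y_def by (rule order_prod)
  have "x \<in> K" using x order_subset_K by blast
  then have xy: "x * y = of_int m" using Norm_multiple[of x] m(1) by (simp add: y_def)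
  have mm: "m * m = 1" using m(2) by (simp add: abs_if split: if_splits)
  have "x * (of_int m * y) = of_int m * (x * y)" by (rule mult.left_commute)
  also have "\<dots> = of_int (m * m)" by (simp only: xy of_int_mult)
  also have "\<dots> = 1" by (simp only: mm of_int_1)
  finally show ?thesis using x order_int_scale[OF y] unfolding mem_Units_ring_on by blast
qed

text \<open>Descent on the absolute value of the norm: it is multiplicative, and nonzero nonunits of
  the order have absolute norm above 1, so both factors of a proper splitting have smaller
  norm.\<close>

lemma order_atomic:
  assumes "x \<in> \<O>" "x \<noteq> 0" "x \<notin> Units (ring_on \<O>)"
  shows "\<exists>ys. ys \<noteq> [] \<and> set ys \<subseteq> Irr \<O> \<and> prod_list ys = x"
proof -
  obtain m where "Norm x = of_int m"
    using Norm_Ints assms(1) order_subset_OK by (blast elim: Ints_cases)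
  with assms show ?thesis
  proof (induction "nat \<bar>m\<bar>" arbitrary: x m rule: less_induct)
    case less
    show ?case
    proof (cases "x \<in> Irr \<O>")
      case True
      then show ?thesis by (intro exI[of _ "[x]"]) simp
    next
      case False
      then obtain b c where bc: "b \<in> \<O>" "c \<in> \<O>" "x = b * c"
        "b \<notin> Units (ring_on \<O>)" "c \<notin> Units (ring_on \<O>)"
        using less.prems(1-3) unfolding mem_Irr_iff by blast
      obtain k l where kl: "Norm b = of_int k" "Norm c = of_int l"
        using Norm_Ints bc(1,2) order_subset_OK by (blast elim: Ints_cases)
      have bcK: "b \<in> K" "c \<in> K" using bc(1,2) order_subset_K by blast+
      have bc0: "b \<noteq> 0" "c \<noteq> 0" using less.prems(2) bc(3) by auto
      have "(of_int m :: 'a) = of_int (k * l)"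
        using Norm_mult[OF bcK] kl bc(3) less.prems(4) by simp
      then have m: "\<bar>m\<bar> = \<bar>k\<bar> * \<bar>l\<bar>" by (simp only: of_int_eq_iff abs_mult)
      have "k \<noteq> 0" "l \<noteq> 0" using kl Norm_eq_0_iff[OF bcK(1)] Norm_eq_0_iff[OF bcK(2)] bc0 by auto
      moreover have "\<bar>k\<bar> \<noteq> 1" "\<bar>l\<bar> \<noteq> 1"
        using abs_Norm_one_imp_unit[OF bc(1) kl(1)] abs_Norm_one_imp_unit[OF bc(2) kl(2)] bc(4,5)
        by blast+
      ultimately have "\<bar>k\<bar> > 1" "\<bar>l\<bar> > 1" by auto
      then have "\<bar>k\<bar> * 1 < \<bar>k\<bar> * \<bar>l\<bar>" "1 * \<bar>l\<bar> < \<bar>k\<bar> * \<bar>l\<bar>"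
        by (intro mult_strict_left_mono mult_strict_right_mono; simp)+
      then have lt: "nat \<bar>k\<bar> < nat \<bar>m\<bar>" "nat \<bar>l\<bar> < nat \<bar>m\<bar>" unfolding m by simp_all
      obtain ys zs where "ys \<noteq> []" "set ys \<subseteq> Irr \<O>" "prod_list ys = b"
        "zs \<noteq> []" "set zs \<subseteq> Irr \<O>" "prod_list zs = c"
        using less.hyps[OF lt(1) bc(1) bc0(1) bc(4) kl(1)]
          less.hyps[OF lt(2) bc(2) bc0(2) bc(5) kl(2)] by blast
      then show ?thesis using bc(3) by (intro exI[of _ "ys @ zs"]) simp
    qed
  qed
qed

text \<open>A norm invertible in the order would be invertible in \<open>OK\<close>, and so would
  its divisor \<open>x\<close>. Thus every norm contributes at least one irreducible.\<close>

lemma Norm_Irr_factorization: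
  assumes "x \<in> Irr OK"
  shows "\<exists>ys. ys \<noteq> [] \<and> set ys \<subseteq> Irr \<O> \<and> prod_list ys = Norm x"
proof (rule order_atomic)
  have x: "x \<in> OK" "x \<noteq> 0" "x \<notin> Units (ring_on OK)" by (rule IrrD[OF assms])+
  have xK: "x \<in> K" using x OK_subset_K by blast
  show "Norm x \<in> \<O>" using Norm_Ints[OF x(1)] order_of_int by (auto elim: Ints_cases)
  show "Norm x \<noteq> 0" using Norm_eq_0_iff[OF xK] x(2) by simp
  define y where "y = (\<Prod>\<sigma>\<in>Gal - {restrict id K}. \<sigma> x)"
  have "\<sigma> x \<in> OK" if "\<sigma> \<in> Gal - {restrict id K}" for \<sigma>
    using Gal_OK[OF x(1)] that by blast
  then have y: "y \<in> OK" unfolding y_def by (rule OK_prod)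
  show "Norm x \<notin> Units (ring_on \<O>)"
  proof
    assume "Norm x \<in> Units (ring_on \<O>)"
    then obtain z where z: "z \<in> OK" "Norm x * z = 1" unfolding units mem_Units_ring_on by blast
    then have "x * (y * z) = 1" using Norm_multiple[OF xK] by (simp add: y_def mult.assoc)
    then show False using x y z OK_mult unfolding mem_Units_ring_on by blast
  qed
qed

section \<open>The lower bound for the elasticity\<close>

text \<open>Factors are indexed by a set so that subproducts are subsets even when factors repeat.
  The case \<open>A = {}\<close> is included and yields elasticity at least 1.\<close>

lemma elasticity_lower_bound:
  assumes A: "finite A" "\<And>i. i \<in> A \<Longrightarrow> f i \<in> Irr OK"
    and no_sub: "\<And>J. J \<noteq> {} \<Longrightarrow> J \<subseteq> A \<Longrightarrow> (\<Prod>i\<in>J. f i) \<notin> \<O>"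
  shows "ereal (1 + real (card A) / real (field_degree K)) \<le> elasticity \<O>"
proof -
  obtain p where p: "p \<noteq> 0" "conductor K \<O> = (*) p ` OK"
    by (rule conductor_generator)
  define q where "q = p * (\<Prod>i\<in>A. f i)"
  have q: "q \<in> Irr \<O>" unfolding q_def
    by (rule conductor_times_product_irreducible[OF p A no_sub])
  \<comment> \<open>The empty product has no nonempty subproduct, so the construction also covers
    \<open>p\<close> itself.\<close>
  have pirr: "p \<in> Irr \<O>"
    using conductor_times_product_irreducible[OF p, of "{}" f] by simp
  from Norm_Irr_factorization[OF A(2)] obtain ys where ys:
    "\<And>i. i \<in> A \<Longrightarrow> ys i \<noteq> []" "\<And>i. i \<in> A \<Longrightarrow> set (ys i) \<subseteq> Irr \<O>"
    "\<And>i. i \<in> A \<Longrightarrow> prod_list (ys i) = Norm (f i)" by metis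
  \<comment> \<open>Conjugates are listed by automorphism, since different automorphisms may agree
    at \<open>p\<close> or \<open>q\<close> and multiplicities count.\<close>
  obtain gs where gs: "set gs = Gal" "distinct gs" using finite_distinct_list[OF finite_Gal] by blast
  obtain js where js: "set js = A" "distinct js" using finite_distinct_list[OF A(1)] by blast
  define as where "as = map (\<lambda>\<sigma>. \<sigma> p) gs @ concat (map ys js)"
  define bs where "bs = map (\<lambda>\<sigma>. \<sigma> q) gs"
  have conj: "set (map (\<lambda>\<sigma>. \<sigma> x) gs) \<subseteq> Irr \<O>" if "x \<in> Irr \<O>" for x
    unfolding set_map gs(1) by (rule image_subsetI) (rule gal_Irr[OF GalD that])
  have as_irr: "set as \<subseteq> Irr \<O>"
    using conj[OF pirr] ys(2) js(1) unfolding as_def by fastforce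
  have bs_irr: "set bs \<subseteq> Irr \<O>" unfolding bs_def by (rule conj[OF q])
  have len_gs: "length gs = card Gal" and len_js: "length js = card A"
    using distinct_card[OF gs(2)] distinct_card[OF js(2)] gs(1) js(1) by simp_all
  \<comment> \<open>Each list \<open>ys i\<close> is nonempty, so concatenation gains at least one
    irreducible per index.\<close>
  have "length ls \<le> length (concat (map ys ls))" if "set ls \<subseteq> A" for ls
    using that
  proof (induction ls)
    case (Cons i ls)
    then have "length (ys i) \<ge> 1" using ys(1)[of i] by (simp add: Suc_le_eq)
    with Cons show ?case by simp
  qed simp
  from this[of js] have len_as: "card Gal + card A \<le> length as"
    using js(1) len_gs len_js by (simp add: as_def)
  have norm: "prod_list (map (\<lambda>\<sigma>. \<sigma> x) gs) = Norm x" for x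
    unfolding Norm_def gs(1)[symmetric] by (rule prod.distinct_set_conv_list[OF gs(2), symmetric])
  have fK: "f i \<in> K" if "i \<in> A" for i
    using IrrD(1)[OF A(2)[OF that]] OK_subset_K by blast
  have Norm_prod: "Norm (prod f J) = (\<Prod>i\<in>J. Norm (f i))" if "finite J" "J \<subseteq> A" for J
    using that
  proof (induction J rule: finite_induct)
    case empty
    have "Norm 1 = (\<Prod>\<sigma>\<in>Gal. 1)" unfolding Norm_def
      by (rule prod.cong[OF refl]) (rule gal_rat[OF GalD Rats_1])
    then show ?case by simp
  next
    case (insert j J)
    have "prod f J \<in> K" using insert.prems by (intro K_prod fK) blast
    then show ?case using insert Norm_mult[of "f j" "prod f J"] fK by simp
  qed
  have pK: "p \<in> K" using IrrD(1)[OF pirr] order_subset_K by blast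
  have "prod_list (concat (map ys js)) = prod_list (map (\<lambda>i. Norm (f i)) js)" 
    if "set js \<subseteq> A" for js
    using that by (induction js) (simp_all add: ys(3))
  from this[of js] have "prod_list (concat (map ys js)) = (\<Prod>i\<in>A. Norm (f i))"
    using js(1) prod.distinct_set_conv_list[OF js(2), of "\<lambda>i. Norm (f i)"] by simp
  then have "prod_list as = Norm p * Norm (prod f A)"
    using Norm_prod[OF A(1)] by (simp add: as_def norm)
  also have "\<dots> = prod_list bs"
    unfolding bs_def norm q_def using fK by (intro Norm_mult[symmetric] pK K_prod)
  finally have eq: "prod_list as = prod_list bs" .
  have g: "card Gal > 0" "card Gal \<le> field_degree K" using card_Gal_pos card_Gal by simp_all
  have "as \<noteq> []" "bs \<noteq> []" using len_as g(1) len_gs by (auto simp: bs_def)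
  then have le: "ereal (real (length as) / real (length bs)) \<le> elasticity \<O>"
    unfolding elasticity_def using as_irr bs_irr eq by (intro Sup_upper) blast
  \<comment> \<open>Passing from the order of the Galois group to the degree only enlarges the
    denominator.\<close>
  have "1 + real (card A) / real (field_degree K) \<le> 1 + real (card A) / real (card Gal)"
    using g by (intro add_left_mono divide_left_mono) auto
  also have "\<dots> = real (card Gal + card A) / real (card Gal)" using g by (simp add: add_divide_distrib)
  also have "\<dots> \<le> real (length as) / real (length bs)"
    using len_as len_gs by (auto simp: bs_def intro!: divide_right_mono)
  finally show ?thesis using le by (meson ereal_less_eq(3) order_trans)
qed

end

section \<open>From the elasticity to the Davenport constant\<close>

theorem theorem2p11:
  fixes K \<O> :: "'a::field_char_0 set"
  assumes "number_field K"
    and "galois_over_rat K"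
    and "class_number K = 1"
    and "is_order K \<O>"
    and "galois_invariant K \<O>"
    and "primeideal (conductor K \<O>) (ring_on (ring_of_integers K))"
    and "Units (ring_on \<O>) = Units (ring_on (ring_of_integers K))"
    and "elasticity \<O> < \<infinity>"
  shows "Davenport_bar K \<O> < \<infinity> \<and>
         ereal_of_enat (Davenport_bar K \<O>)
           \<le> ereal (real (field_degree K)) * (elasticity \<O> - 1) + 1"
proof -
  interpret galois_order K \<O>
    by (intro galois_order.intro galois_number_field.intro galois_order_axioms.intro assms)
  let ?n = "field_degree K"
  let ?P = "subproduct_property \<O> (ring_of_integers K)"
  have n: "?n > 0" using card_Gal card_Gal_pos by linarith
  have bound: "ereal (1 + real m / real ?n) \<le> elasticity \<O>" if not: "\<not> ?P m" for m
  proof -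
    obtain xs where xs: "length xs = m" "set xs \<subseteq> Irr (ring_of_integers K)"
      and "\<not> (\<exists>J. J \<noteq> {} \<and> J \<subseteq> {..<m} \<and> (\<Prod>i\<in>J. xs ! i) \<in> \<O>)"
      using not unfolding subproduct_property_def not_all not_imp by (elim exE conjE)
    then have no_sub: "(\<Prod>i\<in>J. xs ! i) \<notin> \<O>" if "J \<noteq> {}" "J \<subseteq> {..<m}" for J
      using that by blast
    have "xs ! i \<in> Irr (ring_of_integers K)" if "i \<in> {..<m}" for i
      using nth_mem[of i xs] xs that by auto
    from elasticity_lower_bound[OF finite_lessThan this no_sub] show ?thesis by simp
  qed
  \<comment> \<open>A subproduct needs a nonempty index set, so length 0 fails. This makes the
    elasticity at least 1, hence real, and the least good length positive.\<close>
  have P0: "\<not> ?P 0"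
  proof
    assume "?P 0"
    then have "\<exists>J. J \<noteq> {} \<and> J \<subseteq> {..<0::nat} \<and> (\<Prod>i\<in>J. [] ! i) \<in> \<O>"
      unfolding subproduct_property_def by (rule allE[of _ "[]"]) simp
    then show False by simp
  qed
  obtain r where r: "elasticity \<O> = ereal r"
  proof (cases "elasticity \<O>")
    case MInf
    with bound[OF P0] show ?thesis by simp
  qed (use assms(8) in simp_all)
  have P_bound: "real m \<le> real ?n * (r - 1)" if "\<not> ?P m" for m
  proof -
    have "real m / real ?n \<le> r - 1" using bound[OF that] unfolding r by simp
    then show ?thesis using n by (simp only: pos_divide_le_eq of_nat_0_less_iff mult.commute)
  qed
  \<comment> \<open>A length beyond the bound cannot fail, so good lengths exist and the constant is
    finite.\<close>
  obtain m where "real m > real ?n * (r - 1)" using reals_Archimedean2 by blast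
  then have "?P m" using P_bound[of m] by linarith
  define d where "d = (LEAST m. ?P m)"
  have Pd: "?P d" unfolding d_def using \<open>?P m\<close> by (rule LeastI[of ?P])
  have "Davenport_bar K \<O> = enat d"
    unfolding Davenport_bar_def relative_Davenport_def
  proof (rule antisym)
    show "(INF m\<in>{m. ?P m}. enat m) \<le> enat d" by (rule INF_lower) (simp add: Pd)
    show "enat d \<le> (INF m\<in>{m. ?P m}. enat m)"
      by (rule INF_greatest) (simp add: d_def Least_le)
  qed
  moreover have "real d \<le> real ?n * (r - 1) + 1"
  proof -
    \<comment> \<open>The estimate applies to the failing length \<open>d - 1\<close>, which
      accounts for the final \<open>+ 1\<close>.\<close>
    have "d \<noteq> 0" by (rule notI) (use Pd P0 in simp)
    then have "\<not> ?P (d - 1)" using not_less_Least[of "d - 1" ?P] by (simp add: d_def)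
    from P_bound[OF this] show ?thesis using \<open>d \<noteq> 0\<close> by (simp add: of_nat_diff)
  qed
  ultimately show ?thesis by (simp add: r one_ereal_def)
qed

end
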